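(* Let $d \geq 3$ and let $f:\mathbb{P}^1 \to \mathbb{P}^1$ be a degree-$d$ single-cycle Belyi map with combinatorial type $(e_0, e_1, e_\infty)$. Then $f$ admits (i.e. its isomorphism class corresponds to) a planar dessin d'enfant consisting of: \begin{itemize} \item $d - e_1$ white vertices of degree one, each connected to a single black vertex of degree $e_0$; \item $d - e_0$ black vertices of degree one, each connected to a single white vertex of degree $e_1$; and \item $e_0 + e_1 - d$ edges connecting the black vertex of degree $e_0$ and the white vertex of degree $e_1$. \end{itemize}
   Context: A Belyi map is a finite morphism $f: X \to \mathbb{P}^1$ from a smooth projective curve $X$ that is ramified only over $0, 1, \infty$; its genus is the genus of $X$. A Belyi map is a single-cycle Belyi map if it has exactly one ramification point above each of the three branch points $0,1,\infty$ (so it has exactly three critical points; in particular $d\ge 3$). For a genus-$0$ single-cycle Belyi map, its combinatorial type (generating system) $(e_0,e_1,e_\infty)$ records the ramification index $e_i$ of the unique critical point above $i\in\{0,1,\infty\}$; equivalently, the monodromy permutations $\sigma_0,\sigma_1,\sigma_\infty\in S_d$ (with $\sigma_0\sigma_1\sigma_\infty=1$ and $\langle\sigma_0,\sigma_1\rangle$ transitive) each consist of a single nontrivial cycle, of length $e_0,e_1,e_\infty$ respectively. A dessin d'enfant is a connected bipartite graph (black and white vertices) embedded in an orientable surface, with a cyclic ordering of the edges at each vertex. The dessin of $f$ has a black vertex for each point of $f^{-1}(0)$, a white vertex for each point of $f^{-1}(1)$, and an edge for each component of $f^{-1}((0,1))$; equivalently, from a generating system, black vertices correspond to cycles of $\sigma_0$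 (including 1-cycles), white vertices to cycles of $\sigma_1$ (including 1-cycles), edges to $\{1,\dots,d\}$, with cyclic orderings given by the cycles. By Riemann's Existence Theorem, isomorphism classes of degree-$d$ Belyi maps correspond bijectively to isomorphism classes of dessins with $d$ edges. *)

theory Defs
  imports "HOL-Analysis.Analysis" "HOL-Computational_Algebra.Computational_Algebra"
begin

text \<open>
  The complex projective line is the one-point compactification of the complex plane:
  \<open>Some z\<close> is the point \<open>[z : 1]\<close> and \<open>None\<close> is \<open>\<infinity> = [1 : 0]\<close>.
\<close>

type_synonym P1 = "complex option"

definition P1_top :: "P1 topology" where
  "P1_top = Alexandroff_compactification euclidean"

text \<open>
  Every morphism from the projective line to itself is given by a pair of coprime polynomials
  \<open>p\<close>, \<open>q\<close>, as \<open>z \<mapsto> p z / q z\<close>. Homogenised in degree \<open>n = max (deg p) (deg q)\<close>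
  the map is \<open>[P : Q]\<close>, and \<open>[P : Q](1, 0) = [coeff p n : coeff q n]\<close>; this is the value at infinity.
\<close>

definition map_degree :: "complex poly \<Rightarrow> complex poly \<Rightarrow> nat" where
  "map_degree p q = max (degree p) (degree q)"

definition P1_map :: "complex poly \<Rightarrow> complex poly \<Rightarrow> P1 \<Rightarrow> P1" where
  "P1_map p q x = (case x of
     Some z \<Rightarrow> if poly q z = 0 then None else Some (poly p z / poly q z)
   | None \<Rightarrow> let n = map_degree p q
             in if coeff q n = 0 then None else Some (coeff p n / coeff q n))"

text \<open>Order of vanishing at a point of the rational function \<open>r / s\<close>, for nonzero \<open>r\<close>, \<open>s\<close>.\<close>

definition ord_at :: "complex poly \<Rightarrow> complex poly \<Rightarrow> P1 \<Rightarrow> int" where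
  "ord_at r s x = (case x of
     Some z \<Rightarrow> int (order z r) - int (order z s)
   | None \<Rightarrow> int (degree s) - int (degree r))"

text \<open>
  The ramification index of \<open>f = p / q\<close> at \<open>x\<close> is the order at \<open>x\<close> of the pullback of a uniformiser
  at \<open>f x\<close>: of \<open>f - c = (p - c q) / q\<close> if \<open>f x = c\<close> is finite, and of \<open>1 / f = q / p\<close> if
  \<open>f x = \<infinity>\<close>.
\<close>

definition ram_index :: "complex poly \<Rightarrow> complex poly \<Rightarrow> P1 \<Rightarrow> nat" where
  "ram_index p q x = nat (case P1_map p q x of
     Some c \<Rightarrow> ord_at (p - smult c q) q x
   | None \<Rightarrow> ord_at q p x)"

text \<open>A morphism between projective lines is finite iff it is nonconstant, i.e. of positive degree.\<close>

definition belyi_map :: "complex poly \<Rightarrow> complex poly \<Rightarrow> bool" where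
  "belyi_map p q \<longleftrightarrow> coprime p q \<and> map_degree p q > 0 \<and>
     (\<forall>x. ram_index p q x > 1 \<longrightarrow> P1_map p q x \<in> {Some 0, Some 1, None})"

definition single_cycle_belyi_map :: "complex poly \<Rightarrow> complex poly \<Rightarrow> bool" where
  "single_cycle_belyi_map p q \<longleftrightarrow> belyi_map p q \<and>
     (\<forall>c \<in> {Some 0, Some 1, None}. \<exists>!x. P1_map p q x = c \<and> ram_index p q x > 1)"

text \<open>The ramification index of the unique critical point above \<open>c\<close>.\<close>

definition crit_index :: "complex poly \<Rightarrow> complex poly \<Rightarrow> P1 \<Rightarrow> nat" where
  "crit_index p q c = ram_index p q (THE x. P1_map p q x = c \<and> ram_index p q x > 1)"

definition combinatorial_type :: "complex poly \<Rightarrow> complex poly \<Rightarrow> nat \<times> nat \<times> nat" where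
  "combinatorial_type p q = (crit_index p q (Some 0), crit_index p q (Some 1), crit_index p q None)"

text \<open>
  Bipartite graphs drawn on the sphere: an edge is recorded as the open arc that it occupies, without
  its endpoints, so parallel edges are distinct arcs with the same endpoints. The cyclic ordering of
  the edges at each vertex is the one induced by the drawing and the orientation of the sphere, and
  is not stored separately.
\<close>

record drawing =
  black :: "P1 set"
  white :: "P1 set"
  edges :: "P1 set set"

definition edge_arc :: "drawing \<Rightarrow> P1 set \<Rightarrow> bool" where
  "edge_arc D e \<longleftrightarrow> (\<exists>g :: real \<Rightarrow> P1. embedding_map (top_of_set {0..1}) P1_top g \<and>
     g 0 \<in> black D \<and> g 1 \<in> white D \<and> g ` {0<..<1} = e)"

definition planar_dessin :: "drawing \<Rightarrow> bool" where
  "planar_dessin D \<longleftrightarrow>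
     finite (black D) \<and> finite (white D) \<and> finite (edges D) \<and>
     black D \<inter> white D = {} \<and>
     (\<forall>e \<in> edges D. edge_arc D e \<and> e \<inter> (black D \<union> white D) = {}) \<and>
     pairwise disjnt (edges D) \<and>
     connectedin P1_top (black D \<union> white D \<union> \<Union>(edges D))"

definition edges_at :: "drawing \<Rightarrow> P1 \<Rightarrow> P1 set set" where
  "edges_at D v = {e \<in> edges D. v \<in> P1_top closure_of e}"

text \<open>In a dessin there are no loops, so the degree of a vertex is its number of incident edges.\<close>

definition vertex_degree :: "drawing \<Rightarrow> P1 \<Rightarrow> nat" where
  "vertex_degree D v = card (edges_at D v)"

definition edges_between :: "drawing \<Rightarrow> P1 \<Rightarrow> P1 \<Rightarrow> P1 set set" where
  "edges_between D v w = edges_at D v \<inter> edges_at D w"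

definition dessin_of :: "complex poly \<Rightarrow> complex poly \<Rightarrow> drawing" where
  "dessin_of p q =
     \<lparr> black = {x. P1_map p q x = Some 0},
       white = {x. P1_map p q x = Some 1},
       edges = connected_components_of (subtopology P1_top
                 {x. \<exists>t::real. 0 < t \<and> t < 1 \<and> P1_map p q x = Some (complex_of_real t)}) \<rparr>"

end

theory Submission
  imports Defs "HOL-Complex_Analysis.Conformal_Mappings"
begin

text \<open>
  Away from \<open>0\<close>, \<open>1\<close> and \<open>\<infinity>\<close> the map \<open>f = p / q\<close> is a covering of degree \<open>d\<close>, so the open
  interval \<open>(0, 1)\<close> lifts to \<open>d\<close> disjoint arcs, which converge at both ends. After moving a pole to
  \<open>\<infinity>\<close> one has \<open>p - t q = c \<Prod>\<^sub>i (X - g\<^sub>i t)\<close> for \<open>0 < t < 1\<close>, where \<open>g\<^sub>i\<close> are the lifts, and letting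
  \<open>t\<close> tend to \<open>0\<close> or \<open>1\<close> shows that the number of arcs that end at a vertex is its ramification
  index. The preimage of \<open>[0, 1]\<close> is connected: contracting \<open>\<complex> - [0, 1]\<close> towards the segment
  and lifting this contraction through the covering would turn a separation of the preimage into a
  separation of the complement of the poles. The shape of the dessin is then combinatorics: an edge
  that meets neither of the two ramified vertices would be a connected component.
\<close>

section \<open>Coverings from fibre counting\<close>

text \<open>Moving a pole to infinity puts the whole preimage of the affine line into the affine
  plane, and gives \<open>p - smult t q\<close> the same degree and leading coefficient for every t.
  Fibres become root sets of polynomials of one fixed degree, and preimages of bounded sets stay
  bounded. The delicate places are the vertices, where f is no longer a covering. The factorisation
  of \<open>p - smult t q\<close> is an identity of polynomials and passes to the limits t = 0 and t
  = 1; there the multiplicity of a root is at once a ramification index and a number of arc ends,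
  which replaces a local normal form of f. The same obstacle forbids lifting a retraction onto the
  segment, whose ends are branch values. The contraction therefore stops at a small distance from
  the segment, where the preimage already splits.\<close>

lemma covering_space_constant_fibre_card:
  fixes f :: "'a::metric_space \<Rightarrow> 'b::topological_space"
  assumes "open C" "open T" "continuous_on C f" "f ` C \<subseteq> T" "n > 0"
    and card_fibre: "\<And>y. y \<in> T \<Longrightarrow> card {x \<in> C. f x = y} = n"
    and local_inj: "\<And>x. x \<in> C \<Longrightarrow> \<exists>r>0. ball x r \<subseteq> C \<and> inj_on f (ball x r)"
    and open_map: "\<And>V. open V \<Longrightarrow> V \<subseteq> C \<Longrightarrow> open (f ` V)"
  shows "covering_space C f T"
proof
  have fin: "finite {x \<in> C. f x = y}" if "y \<in> T" for y
    using card_fibre[OF that] \<open>n > 0\<close> by (intro card_ge_0_finite) simp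
  show "f ` C = T"
    using card_fibre \<open>n > 0\<close> \<open>f ` C \<subseteq> T\<close> by (force simp: card_gt_0_iff)
  fix y assume y: "y \<in> T"
  define F where "F = {x \<in> C. f x = y}"
  have "finite F" and cardF: "card F = n" and F: "\<And>x. x \<in> F \<Longrightarrow> x \<in> C" "\<And>x. x \<in> F \<Longrightarrow> f x = y"
    using fin[OF y] card_fibre[OF y] by (auto simp: F_def)
  obtain r where r: "\<And>x. x \<in> F \<Longrightarrow> r x > 0 \<and> ball x (r x) \<subseteq> C \<and> inj_on f (ball x (r x))"
    using local_inj F(1) by metis
  have "\<forall>\<^sub>F e in at_right (0::real). \<forall>x\<in>F. e < r x \<and> (\<forall>x'\<in>F. x \<noteq> x' \<longrightarrow> e < dist x x' / 2)"
  proof (intro eventually_ball_finite ballI \<open>finite F\<close> eventually_conj)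
    fix x x' assume "x \<in> F" "x' \<in> F"
    then show "\<forall>\<^sub>F e in at_right 0. e < r x"
      using r by (metis eventually_at_right less_numeral_extra(1) zero_less_one)
    show "\<forall>\<^sub>F e in at_right 0. x \<noteq> x' \<longrightarrow> e < dist x x' / 2"
    proof (cases "x = x'")
      case False
      then have "0 < dist x x' / 2" by simp
      then show ?thesis by (intro eventually_at_rightI[of 0 "dist x x' / 2"]) auto
    qed auto
  qed
  then have "\<forall>\<^sub>F e in at_right (0::real). 0 < e \<and> (\<forall>x\<in>F. e < r x \<and> (\<forall>x'\<in>F. x \<noteq> x' \<longrightarrow> e < dist x x' / 2))"
    using eventually_at_right_less[of 0] by (rule eventually_elim2) auto
  \<comment> \<open>One radius below every \<open>r x\<close> and below half the distance of any two
    points of the fibre, so that the balls are disjoint.\<close>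
  from eventually_happens'[OF trivial_limit_at_right_real this]
  obtain e where "0 < e \<and> (\<forall>x\<in>F. e < r x \<and> (\<forall>x'\<in>F. x \<noteq> x' \<longrightarrow> e < dist x x' / 2))"
    by (rule exE)
  then have e: "e > 0" "\<And>x. x \<in> F \<Longrightarrow> e < r x"
      "\<And>x x'. x \<in> F \<Longrightarrow> x' \<in> F \<Longrightarrow> x \<noteq> x' \<Longrightarrow> e < dist x x' / 2"
    by blast+
  have bC: "ball x e \<subseteq> C" and binj: "inj_on f (ball x e)" if "x \<in> F" for x
    using r[OF that] e(2)[OF that] by (meson inj_on_subset less_imp_le order_trans subset_ball)+
  have bdisj: "x = x'" if "x \<in> F" "x' \<in> F" "z \<in> ball x e" "z \<in> ball x' e" for x x' z
    using e(3)[OF that(1,2)] that(3,4) dist_triangle[of x x' z] by (force simp: dist_commute)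
  \<comment> \<open>A point of \<open>W\<close> has a preimage in each of the n disjoint balls. Its
    fibre has only n points, so none lies elsewhere: the balls, cut down to the preimage of
    \<open>W\<close>, are all the sheets.\<close>
  define W where "W = T \<inter> (\<Inter>x\<in>F. f ` ball x e)"
  have "open W"
    unfolding W_def using \<open>finite F\<close> \<open>open T\<close> bC by (intro open_Int open_INT ballI open_map) auto
  define U where "U x = ball x e \<inter> f -` W" for x
  have openU: "open (U x)" if "x \<in> F" for x
    unfolding U_def
    by (rule continuous_open_preimage[OF continuous_on_subset[OF assms(3) bC[OF that]] open_ball \<open>open W\<close>])
  have imU: "f ` U x = W" if "x \<in> F" for x
  proof -
    have "W \<subseteq> f ` ball x e" using that unfolding W_def by blast
    then show ?thesis unfolding U_def by blast
  qed
  have hom: "\<exists>g. homeomorphism (U x) W f g" if "x \<in> F" for x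
  proof -
    have "continuous_on (U x) f"
      using bC[OF that] assms(3) by (auto simp: U_def intro: continuous_on_subset)
    moreover have "inj_on f (U x)"
      using binj[OF that] by (auto simp: U_def intro: inj_on_subset)
    moreover have "openin (top_of_set W) (f ` V)" if V: "openin (top_of_set (U x)) V" for V
    proof -
      have "open V" "V \<subseteq> U x"
        using V openU[OF \<open>x \<in> F\<close>] by (auto simp: openin_open_eq)
      then have "open (f ` V)"
        using bC[OF \<open>x \<in> F\<close>] by (intro open_map) (auto simp: U_def)
      moreover have "f ` V \<subseteq> W"
        using \<open>V \<subseteq> U x\<close> by (auto simp: U_def)
      ultimately show ?thesis
        by (simp add: \<open>open W\<close> openin_open_eq)
    qed
    ultimately show ?thesis
      using imU[OF that] homeomorphism_injective_open_map by metis
  qed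
  have union: "\<Union>(U ` F) = C \<inter> f -` W"
  proof
    show "\<Union>(U ` F) \<subseteq> C \<inter> f -` W"
      using bC by (auto simp: U_def)
    show "C \<inter> f -` W \<subseteq> \<Union>(U ` F)"
    proof
      fix z assume z: "z \<in> C \<inter> f -` W"
      have "\<exists>z'. z' \<in> U x \<and> f z' = f z" if "x \<in> F" for x
        using imU[OF that] z by (metis IntE image_iff vimageE)
      then obtain s where s: "\<And>x. x \<in> F \<Longrightarrow> s x \<in> U x \<and> f (s x) = f z"
        by metis
      have "inj_on s F"
        using s bdisj unfolding inj_on_def U_def by (metis IntE)
      then have "card (s ` F) = n" by (simp add: card_image cardF)
      moreover have "s ` F \<subseteq> {x \<in> C. f x = f z}"
        using s bC unfolding U_def by blast
      moreover have "f z \<in> T" using z by (auto simp: W_def)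
      ultimately have "s ` F = {x \<in> C. f x = f z}"
        using card_fibre[of "f z"] fin[of "f z"] by (intro card_subset_eq) auto
      then have "z \<in> s ` F" using z by auto
      then show "z \<in> \<Union>(U ` F)" using s by auto
    qed
  qed
  have "pairwise disjnt (U ` F)"
    unfolding pairwise_def disjnt_def using bdisj by (fastforce simp: U_def)
  moreover have "\<forall>u\<in>U ` F. openin (top_of_set C) u"
    using openU bC \<open>open C\<close> by (auto simp: openin_open_eq U_def)
  ultimately show "\<exists>W. y \<in> W \<and> openin (top_of_set T) W \<and>
            (\<exists>v. \<Union> v = C \<inter> f -` W \<and> (\<forall>u\<in>v. openin (top_of_set C) u) \<and>
                 pairwise disjnt v \<and> (\<forall>u\<in>v. \<exists>q. homeomorphism u W f q))"
    using union hom e(1) F y \<open>open W\<close>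
    by (intro exI[of _ W] conjI exI[of _ "U ` F"])
       (force simp: W_def openin_open_eq assms(2))+
qed fact

section \<open>Rational functions with a pole at infinity\<close>

text \<open>\<open>unramified\<close> says that \<open>p - smult t q\<close> has no multiple root
  unless t is 0 or 1, which is the form in which absence of ramification enters the counting of
  roots. By \<open>degree_less\<close> infinity is a pole, so every point with a finite value lies
  in the plane.\<close>

locale finite_part_cover =
  fixes p q :: "complex poly"
  assumes degree_less: "degree q < degree p"
    and no_common_root: "\<And>z. poly p z = 0 \<Longrightarrow> poly q z \<noteq> 0"
    and unramified: "\<And>t z. t \<noteq> 0 \<Longrightarrow> t \<noteq> 1 \<Longrightarrow> poly p z = t * poly q z \<Longrightarrow>
          poly (pderiv p) z \<noteq> t * poly (pderiv q) z"
begin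

definition f :: "complex \<Rightarrow> complex" where "f z = poly p z / poly q z"

definition S :: "complex set" where "S = {z. poly q z \<noteq> 0}"

lemma p_nonzero: "p \<noteq> 0" and q_nonzero: "q \<noteq> 0"
proof -
  show "p \<noteq> 0" using degree_less by auto
  have "\<not> constant (poly p)" using degree_less by (simp add: constant_degree)
  then obtain z where "poly p z = 0" using Fundamental_Theorem_Algebra.fundamental_theorem_of_algebra by blast
  then show "q \<noteq> 0" using no_common_root by force
qed

text \<open>A zero of q on the right-hand side would also be a zero of p. Hence fibres of f are
  exactly root sets of polynomials, with no condition on q left over.\<close>

lemma f_eq_iff: "z \<in> S \<and> f z = t \<longleftrightarrow> poly p z = t * poly q z"
  using no_common_root by (auto simp: f_def S_def field_simps)

lemma open_S: "open S"
  unfolding S_def by (simp add: continuous_intros open_Collect_neq)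

lemma connected_S: "connected S"
proof -
  have "S = UNIV - {z. poly q z = 0}" by (auto simp: S_def)
  then show ?thesis
    using connected_open_diff_countable[of "UNIV::complex set" "{z. poly q z = 0}"] poly_roots_finite[OF q_nonzero]
    by (simp add: countable_finite convex_connected)
qed

lemma holomorphic_f: "f holomorphic_on S"
  unfolding f_def S_def by (auto intro!: holomorphic_intros)

text \<open>Here \<open>p - smult t q\<close> is squarefree of degree \<open>degree p\<close>, so it
  has as many distinct roots as its degree.\<close>

lemma fibre_card:
  assumes "t \<noteq> 0" "t \<noteq> 1"
  shows "card {z \<in> S. f z = t} = degree p"
proof -
  let ?P = "p - smult t q"
  have deg: "degree ?P = degree p"
    using degree_less degree_smult_le[of t q] degree_add_eq_left[of "- smult t q" p] by simp
  have "rsquarefree ?P"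
    unfolding rsquarefree_roots using unramified[OF assms] by (auto simp: pderiv_diff pderiv_smult)
  from complex_poly_decompose_rsquarefree[OF this]
  have "degree ?P = degree (smult (lead_coeff ?P) (\<Prod>z|poly ?P z = 0. [:-z, 1:]))" by simp
  also have "\<dots> = card {z. poly ?P z = 0}"
    using deg degree_less by (subst degree_smult_eq) (auto simp: degree_prod_sum_eq coeff_eq_0)
  finally show ?thesis
    using f_eq_iff by (simp add: deg)
qed

text \<open>Substituting \<open>p = f z * q\<close> at z into the quotient rule leaves
  \<open>(p' - f z * q') / q\<close>, and \<open>unramified\<close> says that this is
  nonzero.\<close>

lemma local_injective:
  assumes "z \<in> S" "f z \<noteq> 0" "f z \<noteq> 1"
  shows "\<exists>r>0. ball z r \<subseteq> S \<and> inj_on f (ball z r)"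
proof -
  have q: "poly q z \<noteq> 0" and pz: "poly p z = f z * poly q z"
    using assms(1) f_eq_iff by (auto simp: S_def)
  have "(f has_field_derivative
      (poly (pderiv p) z * poly q z - poly p z * poly (pderiv q) z) / (poly q z * poly q z)) (at z)"
    unfolding f_def[abs_def] using q by (auto intro!: derivative_eq_intros)
  then have "deriv f z = (poly (pderiv p) z - f z * poly (pderiv q) z) / poly q z"
    using q by (simp add: DERIV_imp_deriv pz field_simps)
  then have "deriv f z \<noteq> 0"
    using unramified[OF assms(2,3) pz] q by simp
  then show ?thesis
    using has_complex_derivative_locally_invertible[OF holomorphic_f assms(1) open_S] by metis
qed

lemma open_preimage: "open T \<Longrightarrow> open (S \<inter> f -` T)"
  using holomorphic_f open_S by (metis continuous_on_open_vimage holomorphic_on_imp_continuous_on inf_commute)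

lemma open_image:
  assumes V: "open V" "V \<subseteq> S" "f ` V \<inter> {0,1} = {}"
  shows "open (f ` V)"
proof (subst open_subopen, intro ballI)
  fix y assume "y \<in> f ` V"
  then obtain z where z: "z \<in> V" "y = f z" by auto
  obtain r where r: "r > 0" "inj_on f (ball z r)" using local_injective[of z] z V by blast
  obtain e where e: "e > 0" "ball z e \<subseteq> V" using V z open_contains_ball by blast
  have "open (f ` ball z (min r e))"
  proof (rule open_mapping_thm3)
    show "f holomorphic_on ball z (min r e)"
      using e V by (intro holomorphic_on_subset[OF holomorphic_f]) auto
    show "inj_on f (ball z (min r e))" using r(2) by (rule inj_on_subset) auto
  qed auto
  moreover have "z \<in> ball z (min r e)" "ball z (min r e) \<subseteq> V"
    using e r by auto
  ultimately show "\<exists>T. open T \<and> y \<in> T \<and> T \<subseteq> f ` V"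
    using z by blast
qed

text \<open>Two instances matter: the complement of \<open>{0,1}\<close>, through which the interval
  is lifted, and the complement of the segment, where the contraction is lifted.\<close>

lemma covering:
  assumes "open T" "0 \<notin> T" "1 \<notin> T"
  shows "covering_space (S \<inter> f -` T) f T"
proof (rule covering_space_constant_fibre_card[where n = "degree p"])
  show o: "open (S \<inter> f -` T)" using open_preimage assms by auto
  show "continuous_on (S \<inter> f -` T) f"
    using holomorphic_f by (auto intro: holomorphic_on_imp_continuous_on continuous_on_subset)
  show li: "\<exists>r>0. ball z r \<subseteq> S \<inter> f -` T \<and> inj_on f (ball z r)" if z: "z \<in> S \<inter> f -` T" for z
  proof -
    obtain r where r: "r > 0" "inj_on f (ball z r)"
      using local_injective[of z] z assms by (metis IntE vimageE)
    obtain e where "e > 0" "ball z e \<subseteq> S \<inter> f -` T"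
      using o z open_contains_ball by blast
    then show ?thesis
      using r by (intro exI[of _ "min r e"]) (auto intro: inj_on_subset)
  qed
  show "open (f ` V)" if "open V" "V \<subseteq> S \<inter> f -` T" for V
    using that assms by (intro open_image) auto
  show "card {z \<in> S \<inter> f -` T. f z = y} = degree p" if "y \<in> T" for y
  proof -
    have "{z \<in> S \<inter> f -` T. f z = y} = {z \<in> S. f z = y}" using that by auto
    then show ?thesis using fibre_card[of y] that assms by metis
  qed
qed (use assms degree_less in auto)

text \<open>A nonzero solution t of \<open>p = t q\<close> with norm at most R makes
  \<open>q / p\<close> at least \<open>1 / (\<bar>R\<bar> + 1)\<close> in norm, while this quotient
  tends to 0 at infinity. Using \<open>\<bar>R\<bar> + 1\<close> keeps the bound positive for every
  real R.\<close>

lemma proper: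
  obtains B where "\<And>z t. norm t \<le> R \<Longrightarrow> poly p z = t * poly q z \<Longrightarrow> norm z \<le> B"
proof -
  have "\<forall>\<^sub>F z in at_infinity. norm (poly q z / poly p z) < 1 / (\<bar>R\<bar> + 1)"
    using tendstoD[OF poly_divide_tendsto_0_at_infinity[OF degree_less], of "1 / (\<bar>R\<bar> + 1)"] by simp
  moreover have "\<forall>\<^sub>F z in at_infinity. poly p z \<noteq> 0"
    using filterlim_at_infinity_imp_eventually_ne[OF filterlim_poly_at_infinity[of p]] degree_less by simp
  ultimately have "\<forall>\<^sub>F z in at_infinity. norm (poly q z / poly p z) < 1 / (\<bar>R\<bar> + 1) \<and> poly p z \<noteq> 0"
    by eventually_elim auto
  then obtain B where B: "\<And>z. B \<le> norm z \<Longrightarrow> norm (poly q z / poly p z) < 1 / (\<bar>R\<bar> + 1) \<and> poly p z \<noteq> 0"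
    unfolding eventually_at_infinity by blast
  show thesis
  proof (rule that[of B])
    fix z t assume t: "norm t \<le> R" "poly p z = t * poly q z"
    show "norm z \<le> B"
    proof (rule ccontr)
      assume "\<not> norm z \<le> B"
      then have *: "norm (poly q z / poly p z) < 1 / (\<bar>R\<bar> + 1)" "poly p z \<noteq> 0"
        using B[of z] by auto
      then have "t \<noteq> 0" "poly q z \<noteq> 0" using t by auto
      then have "norm (poly q z / poly p z) = 1 / norm t" by (simp add: t norm_divide norm_mult)
      moreover have "1 / norm t \<ge> 1 / (\<bar>R\<bar> + 1)"
        using t \<open>t \<noteq> 0\<close> by (intro divide_left_mono) auto
      ultimately show False using * by simp
    qed
  qed
qed

text \<open>The equation \<open>p z = t * q z\<close> is closed in the pairs (z, t), also across the
  poles. The preimage is the projection of its solutions with t in K, which \<open>proper\<close>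
  confines to a ball.\<close>

lemma compact_preimage:
  assumes "compact K"
  shows "compact (S \<inter> f -` K)"
proof -
  obtain R where R: "\<And>t. t \<in> K \<Longrightarrow> norm t \<le> R"
    using assms compact_imp_bounded bounded_iff by metis
  obtain B where B: "\<And>z t. norm t \<le> R \<Longrightarrow> poly p z = t * poly q z \<Longrightarrow> norm z \<le> B"
    using proper by blast
  have "closed {x :: complex \<times> complex. poly p (fst x) = snd x * poly q (fst x)}"
    by (intro closed_Collect_eq continuous_intros)
  then have "compact (cball 0 B \<times> K \<inter> {x. poly p (fst x) = snd x * poly q (fst x)})"
    using assms by (intro compact_Int_closed compact_Times) auto
  then have "compact (fst ` (cball 0 B \<times> K \<inter> {x. poly p (fst x) = snd x * poly q (fst x)}))"
    by (intro compact_continuous_image continuous_intros)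
  also have "fst ` (cball 0 B \<times> K \<inter> {x. poly p (fst x) = snd x * poly q (fst x)}) = S \<inter> f -` K"
  proof (intro set_eqI iffI)
    fix z assume "z \<in> S \<inter> f -` K"
    then have "f z \<in> K" "poly p z = f z * poly q z" using f_eq_iff by auto
    then show "z \<in> fst ` (cball 0 B \<times> K \<inter> {x. poly p (fst x) = snd x * poly q (fst x)})"
      using B R by (intro image_eqI[of _ _ "(z, f z)"]) auto
  next
    fix z assume "z \<in> fst ` (cball 0 B \<times> K \<inter> {x. poly p (fst x) = snd x * poly q (fst x)})"
    then obtain t where "t \<in> K" "poly p z = t * poly q z" by auto
    then have "z \<in> S" "f z \<in> K" using f_eq_iff[of z t] by simp_all
    then show "z \<in> S \<inter> f -` K" by simp
  qed
  finally show ?thesis .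
qed

text \<open>A separation of the preimage \<open>Z\<close> extends to a neighbourhood
  \<open>N\<close> of it. The lifted contraction ends in \<open>N\<close>, so every point off
  \<open>Z\<close> inherits a side from the end of its path. The two rules agree on the overlap
  because paths that start in \<open>N\<close> stay in \<open>N\<close>. This separates
  \<open>S\<close>, a plane without finitely many points.\<close>

lemma connected_preimage_segment:
  "connected (S \<inter> f -` closed_segment 0 1)"
proof (rule ccontr)
  define I where "I = closed_segment 0 (1::complex)"
  define \<pi> where "\<pi> = closest_point I"
  have I: "compact I" "closed I" "convex I" "I \<noteq> {}" "0 \<in> I" "1 \<in> I"
    by (auto simp: I_def intro: compact_imp_closed)
  have \<pi>_in: "\<pi> w \<in> I" and \<pi>_le: "y \<in> I \<Longrightarrow> dist w (\<pi> w) \<le> dist w y" for w y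
    using I by (auto simp: \<pi>_def closest_point_in_set closest_point_le)
  have cont_\<pi>: "continuous_on A \<pi>" for A
    unfolding \<pi>_def by (intro continuous_on_closest_point I)
  note cont_\<pi>' = continuous_on_compose2[OF cont_\<pi>[of UNIV], simplified]
  define Z where "Z = S \<inter> f -` I"
  assume "\<not> connected (S \<inter> f -` closed_segment 0 1)"
  moreover have "compact Z" unfolding Z_def by (intro compact_preimage I)
  ultimately obtain A B where AB: "closed A" "closed B" "A \<noteq> {}" "B \<noteq> {}" "A \<union> B = Z" "A \<inter> B = {}"
    using connected_closed_set[of Z] by (auto simp: Z_def I_def compact_imp_closed)
  have "compact A" using AB \<open>compact Z\<close> by (metis Un_upper1 closed_Int_compact inf.absorb1)
  then obtain UA UB where U: "open UA" "open UB" "A \<subseteq> UA" "B \<subseteq> UB" "UA \<inter> UB = {}"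
    using separation_normal_compact[OF _ AB(2,6)] by metis
  have contf: "continuous_on A f" if "A \<subseteq> S" for A
    using holomorphic_f that by (meson continuous_on_subset holomorphic_on_imp_continuous_on)

  \<comment> \<open>On the part \<open>M\<close> of the preimage outside
    \<open>UA \<union> UB\<close>, the distance of \<open>f z\<close> to the segment has a positive
    minimum, since distance 0 would mean a point of \<open>Z\<close>. The cut-off at distance 1
    makes \<open>M\<close> compact.\<close>
  obtain \<delta> where \<delta>: "\<delta> > 0" "\<And>z. z \<in> S \<Longrightarrow> dist (f z) (\<pi> (f z)) < \<delta> \<Longrightarrow> z \<in> UA \<union> UB"
  proof -
    define M where "M = S \<inter> f -` {w. dist w (\<pi> w) \<le> 1} - (UA \<union> UB)"
    have "compact {w. dist w (\<pi> w) \<le> 1}"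
    proof -
      obtain R where R: "\<And>t. t \<in> I \<Longrightarrow> norm t \<le> R"
        using I compact_imp_bounded bounded_iff by metis
      have "norm w \<le> R + 1" if "dist w (\<pi> w) \<le> 1" for w
        using R[OF \<pi>_in, of w] that norm_triangle_ineq2[of w "\<pi> w"] by (simp add: dist_norm)
      then have "bounded {w. dist w (\<pi> w) \<le> 1}" by (auto simp: bounded_iff)
      moreover have "closed {w. dist w (\<pi> w) \<le> 1}"
        by (intro closed_Collect_le continuous_intros cont_\<pi>)
      ultimately show ?thesis by (simp add: compact_eq_bounded_closed)
    qed
    then have "compact M"
      unfolding M_def using U by (intro compact_diff compact_preimage) auto
    show thesis
    proof (cases "M = {}")
      case True
      then show ?thesis by (intro that[of 1]) (auto simp: M_def)
    next
      case False
      have "continuous_on M (\<lambda>z. dist (f z) (\<pi> (f z)))"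
        by (intro continuous_intros cont_\<pi>' contf) (auto simp: M_def)
      then obtain m where m: "m \<in> M" "\<And>z. z \<in> M \<Longrightarrow> dist (f m) (\<pi> (f m)) \<le> dist (f z) (\<pi> (f z))"
        using continuous_attains_inf[OF \<open>compact M\<close> False] by blast
      have "f m \<noteq> \<pi> (f m)"
      proof
        assume "f m = \<pi> (f m)"
        then have "f m \<in> I" using \<pi>_in[of "f m"] by simp
        then have "m \<in> Z" using m by (auto simp: M_def Z_def)
        then show False using m U AB by (auto simp: M_def)
      qed
      then show ?thesis
        using m by (intro that[of "min 1 (dist (f m) (\<pi> (f m)))"]) (force simp: M_def)+
    qed
  qed

  txt \<open>\<open>H s w\<close> stays on the segment from \<open>\<pi> w\<close> to \<open>w\<close> and off \<open>I\<close>; at \<open>s = 1\<close> it is closer than \<open>\<delta>\<close> to \<open>I\<close>.\<close>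
  define lam where "lam s w = (1 - s) + s * (\<delta> / (\<delta> + dist w (\<pi> w)))" for s w
  define H where "H s w = \<pi> w + complex_of_real (lam s w) * (w - \<pi> w)" for s w
  have lam: "0 < lam s w" "lam s w \<le> 1" if "s \<in> {0..1}" for s w
  proof -
    define c where "c = \<delta> / (\<delta> + dist w (\<pi> w))"
    have c: "0 < c" "c \<le> 1"
      using \<delta> by (auto simp: c_def add_pos_nonneg)
    show "lam s w \<le> 1"
      using that mult_left_le[of c s] c unfolding lam_def c_def by auto
    show "0 < lam s w"
      using that mult_pos_pos[of s c] c unfolding lam_def c_def by (cases "s = 0") auto
  qed
  have dist_H: "dist (H s w) (\<pi> w) = lam s w * dist w (\<pi> w)" if "s \<in> {0..1}" for s w
    using lam[OF that] by (simp add: H_def dist_norm norm_mult abs_of_pos less_imp_le)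
  \<comment> \<open>At s = 1 a distance x shrinks to \<open>\<delta> * x / (\<delta> + x)\<close>,
    which is below \<open>\<delta>\<close>; at other times a factor at most 1 preserves a distance
    already below \<open>\<delta>\<close>. The point \<open>\<pi> w\<close> bounds the distance of
    \<open>H s w\<close> to its own nearest point.\<close>
  have H_near: "dist (H s w) (\<pi> (H s w)) < \<delta>" if "s \<in> {0..1}" "s = 1 \<or> dist w (\<pi> w) < \<delta>" for s w
  proof -
    have "lam s w * dist w (\<pi> w) < \<delta>"
      using that(2)
    proof
      assume "s = 1"
      then have "lam s w * dist w (\<pi> w) = \<delta> * (dist w (\<pi> w) / (\<delta> + dist w (\<pi> w)))"
        by (simp add: lam_def)
      also have "\<dots> < \<delta> * 1"
        using \<delta> by (intro mult_strict_left_mono) (auto simp: divide_simps add_pos_nonneg)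
      finally show ?thesis by simp
    next
      assume "dist w (\<pi> w) < \<delta>"
      then show ?thesis
        using lam[OF that(1), of w] by (smt (verit) mult_left_le_one_le zero_le_dist)
    qed
    then show ?thesis
      using \<pi>_le[OF \<pi>_in, of "H s w" w] dist_H[OF that(1)] by simp
  qed
  \<comment> \<open>\<open>H s w\<close> is strictly nearer to w than \<open>\<pi> w\<close> is,
    because \<open>lam s w > 0\<close>; a point of the segment cannot be.\<close>
  have H_notin: "H s w \<notin> I" if "s \<in> {0..1}" "w \<notin> I" for s w
  proof
    assume "H s w \<in> I"
    then have "dist w (\<pi> w) \<le> dist w (H s w)" by (rule \<pi>_le)
    also have "w - H s w = complex_of_real (1 - lam s w) * (w - \<pi> w)"
      by (simp add: H_def algebra_simps)
    then have "dist w (H s w) = (1 - lam s w) * dist w (\<pi> w)"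
      using lam[OF that(1), of w] unfolding dist_norm
      by (metis abs_of_nonneg diff_ge_0_iff_ge norm_mult norm_of_real)
    finally have "lam s w * dist w (\<pi> w) \<le> 0" by (simp add: algebra_simps)
    moreover have "w \<noteq> \<pi> w" using \<pi>_in that(2) by metis
    ultimately show False using lam[OF that(1), of w]
      by (metis dist_pos_lt mult_pos_pos not_less)
  qed

  define C where "C = S \<inter> f -` (- I)"
  have cov: "covering_space C f (- I)"
    unfolding C_def using I by (intro covering) auto
  have "open C" unfolding C_def using I by (intro open_preimage) auto
  have "\<delta> + dist w (\<pi> w) \<noteq> 0" for w using \<delta> by (smt (verit) zero_le_dist)
  then have "continuous_on ({0..1} \<times> C) (\<lambda>x. H (fst x) (f (snd x)))"
    unfolding H_def lam_def
    by (intro continuous_intros cont_\<pi>' continuous_on_compose2[OF contf[of C]]) (auto simp: C_def)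
  moreover have "(\<lambda>x. H (fst x) (f (snd x))) \<in> {0..1} \<times> C \<rightarrow> - I"
    using H_notin by (auto simp: C_def)
  moreover have "H (fst (0, z)) (f (snd (0, z))) = f (id z)" for z
    by (simp add: H_def lam_def)
  ultimately obtain k where k: "continuous_on ({0..1} \<times> C) k" "k \<in> {0..1} \<times> C \<rightarrow> C"
      "\<And>z. z \<in> C \<Longrightarrow> k (0, z) = id z" "\<And>x. x \<in> {0..1} \<times> C \<Longrightarrow> H (fst x) (f (snd x)) = f (k x)"
    using covering_space_lift_homotopy[OF cov, of C "\<lambda>x. H (fst x) (f (snd x))" id] by auto
  define r where "r z = k (1, z)" for z
  have contr: "continuous_on C r"
    unfolding r_def by (intro continuous_on_compose2[OF k(1)] continuous_intros) auto
  define N where "N = S \<inter> f -` {w. dist w (\<pi> w) < \<delta>}"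
  have "open {w. dist w (\<pi> w) < \<delta>}"
    by (intro open_Collect_less continuous_intros cont_\<pi>)
  then have "open N" unfolding N_def by (intro open_preimage)
  have N: "N \<subseteq> UA \<union> UB" using \<delta> by (auto simp: N_def)
  have kN: "k (s, z) \<in> N" if "s \<in> {0..1}" "z \<in> C" "s = 1 \<or> z \<in> N" for s z
  proof -
    have "k (s, z) \<in> S" using that k(2) by (auto simp: C_def)
    then show ?thesis
      using k(4)[of "(s, z)"] that H_near[of s "f z"] by (auto simp: N_def)
  qed
  \<comment> \<open>The lifted path from z to \<open>r z\<close> is connected and stays in
    \<open>N\<close>, so it cannot change sides. \<open>U\<close> and \<open>V\<close> are variables
    so that the argument serves both sides.\<close>
  have same_side: "r z \<in> U"
    if z: "z \<in> C" "z \<in> N" "z \<in> U" and U: "open U" "open V" "U \<inter> V = {}" "UA \<union> UB = U \<union> V" for z U V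
  proof -
    have "connected ((\<lambda>s. k (s, z)) ` {0..1})"
      by (intro connected_continuous_image continuous_on_compose2[OF k(1)] continuous_intros) (use z in auto)
    moreover have "(\<lambda>s. k (s, z)) ` {0..1} \<subseteq> U \<union> V"
      using kN z N U(4) by blast
    moreover have "k (0, z) = z" using k(3) z by simp
    then have "z \<in> (\<lambda>s. k (s, z)) ` {0..1}" by (intro image_eqI[of _ _ 0]) auto
    ultimately have "V \<inter> (\<lambda>s. k (s, z)) ` {0..1} = {}"
      using connectedD[of "(\<lambda>s. k (s, z)) ` {0..1}" U V] U z by blast
    moreover have "r z \<in> (\<lambda>s. k (s, z)) ` {0..1}" by (auto simp: r_def)
    ultimately show ?thesis using \<open>(\<lambda>s. k (s, z)) ` {0..1} \<subseteq> U \<union> V\<close> by blast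
  qed
  have rA: "r z \<in> UA" if "z \<in> C" "z \<in> N" "z \<in> UA" for z
    using same_side[OF that, of UB] U by auto
  have rB: "r z \<in> UB" if "z \<in> C" "z \<in> N" "z \<in> UB" for z
    using same_side[OF that, of UA] U by auto
  \<comment> \<open>Off the segment the side is read at the end of the lifted contraction. Points of
    \<open>Z\<close> have no lifted path, and there the second piece reads it directly.\<close>
  define EA where "EA = (C \<inter> r -` UA) \<union> (UA \<inter> N)"
  define EB where "EB = (C \<inter> r -` UB) \<union> (UB \<inter> N)"
  have "open EA" "open EB"
    unfolding EA_def EB_def using contr \<open>open C\<close> \<open>open N\<close> U
    by (auto intro!: open_Un open_Int[of UA N] open_Int[of UB N] continuous_open_preimage)
  have ZN: "Z \<subseteq> N"
  proof
    fix z assume "z \<in> Z"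
    then have "z \<in> S" "f z \<in> I" by (auto simp: Z_def)
    then show "z \<in> N" using \<delta> by (simp add: N_def \<pi>_def closest_point_self)
  qed
  have "S \<subseteq> EA \<union> EB"
  proof
    fix z assume "z \<in> S"
    show "z \<in> EA \<union> EB"
    proof (cases "z \<in> C")
      case True
      then have "r z \<in> N" using kN[of 1 z] by (simp add: r_def)
      then show ?thesis using N True by (auto simp: EA_def EB_def)
    next
      case False
      then have "z \<in> Z" using \<open>z \<in> S\<close> by (auto simp: C_def Z_def)
      then show ?thesis using ZN AB U by (auto simp: EA_def EB_def)
    qed
  qed
  moreover have "EA \<inter> EB = {}"
    unfolding EA_def EB_def using rA rB U(5) by blast
  moreover have "EA \<inter> S \<noteq> {}" "EB \<inter> S \<noteq> {}"
  proof -
    have "A \<subseteq> EA" "B \<subseteq> EB" "A \<subseteq> S" "B \<subseteq> S"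
      using ZN AB U by (auto simp: EA_def EB_def Z_def)
    then show "EA \<inter> S \<noteq> {}" "EB \<inter> S \<noteq> {}" using AB by blast+
  qed
  ultimately show False
    using connectedD[OF connected_S \<open>open EA\<close> \<open>open EB\<close>] by blast
qed

text \<open>As t tends to c, the value of \<open>p - smult c q\<close> at \<open>\<gamma> t\<close>
  is \<open>(t - c) * q (\<gamma> t)\<close> and tends to 0, so \<open>\<gamma> t\<close> approaches
  the finite root set. By connectedness it cannot jump between disjoint balls about different roots,
  so a single root is the limit.\<close>

lemma lift_endpoint_limit:
  fixes \<gamma> :: "real \<Rightarrow> complex"
  assumes cont: "continuous_on {0<..<1} \<gamma>"
    and lift: "\<And>t. t \<in> {0<..<1} \<Longrightarrow> poly p (\<gamma> t) = of_real t * poly q (\<gamma> t)"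
    and c: "c = 0 \<or> c = 1"
  shows "\<exists>l. (\<gamma> \<longlongrightarrow> l) (at c within {0<..<1})"
proof -
  obtain B where B: "\<And>z t. norm t \<le> 1 \<Longrightarrow> poly p z = t * poly q z \<Longrightarrow> norm z \<le> B"
    using proper by blast
  define P where "P = p - smult (of_real c) q"
  have "degree P = degree p"
    unfolding P_def using degree_less degree_smult_le[of "of_real c" q]
      degree_add_eq_left[of "- smult (of_real c) q" p] by simp
  then have "P \<noteq> 0" using degree_less by auto
  define F where "F = {z. poly P z = 0}"
  have "finite F" unfolding F_def using \<open>P \<noteq> 0\<close> by (rule poly_roots_finite)
  obtain M where M: "\<And>z. z \<in> cball 0 B \<Longrightarrow> norm (poly q z) \<le> M"
  proof -
    have "bounded (poly q ` cball 0 B)"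
      by (intro compact_imp_bounded compact_continuous_image continuous_intros) auto
    then obtain M where "\<forall>x\<in>poly q ` cball 0 B. norm x \<le> M" by (auto simp: bounded_iff)
    then show thesis by (intro that[of M]) auto
  qed
  have near: "\<exists>\<eta>>0. \<forall>t\<in>{0<..<1}. dist t c < \<eta> \<longrightarrow> (\<exists>v\<in>F. \<gamma> t \<in> ball v \<epsilon>)" if "\<epsilon> > 0" for \<epsilon>
  proof -
    \<comment> \<open>On \<open>K\<close>, away from the roots, \<open>P\<close> is at least some
      \<open>m > 0\<close> in norm. Once t is within \<open>m / (\<bar>M\<bar> + 1)\<close> of c,
      the norm of \<open>P\<close> at \<open>\<gamma> t\<close> is below m, which excludes
      \<open>K\<close>.\<close>
    define K where "K = cball 0 B - (\<Union>v\<in>F. ball v \<epsilon>)"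
    have "compact K" unfolding K_def by (intro compact_diff) auto
    obtain m where m: "m > 0" "\<And>z. z \<in> K \<Longrightarrow> m \<le> norm (poly P z)"
    proof (cases "K = {}")
      case False
      have "continuous_on K (\<lambda>z. norm (poly P z))" by (intro continuous_intros)
      from continuous_attains_inf[OF \<open>compact K\<close> False this]
      obtain z0 where "z0 \<in> K" "\<And>z. z \<in> K \<Longrightarrow> norm (poly P z0) \<le> norm (poly P z)" by blast
      then show thesis
        using that[of "norm (poly P z0)"] \<open>\<epsilon> > 0\<close> by (force simp: K_def F_def)
    qed (use that[of 1] in auto)
    show ?thesis
    proof (intro exI conjI ballI impI)
      show "m / (\<bar>M\<bar> + 1) > 0" using m by simp
      fix t assume t: "t \<in> {0<..<1}" "dist t c < m / (\<bar>M\<bar> + 1)"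
      have g: "\<gamma> t \<in> cball 0 B" using B[of "of_real t" "\<gamma> t"] lift t by auto
      have "poly P (\<gamma> t) = of_real (t - c) * poly q (\<gamma> t)"
        using lift[OF t(1)] by (simp add: P_def algebra_simps)
      then have "norm (poly P (\<gamma> t)) = dist t c * norm (poly q (\<gamma> t))"
        by (simp only: norm_mult norm_of_real dist_real_def)
      also have "\<dots> \<le> dist t c * (\<bar>M\<bar> + 1)"
        using M[OF g] by (intro mult_left_mono) auto
      also have "\<dots> < m" using t(2) by (simp add: field_simps)
      finally have "\<gamma> t \<notin> K" using m by force
      then show "\<exists>v\<in>F. \<gamma> t \<in> ball v \<epsilon>" using g by (auto simp: K_def)
    qed
  qed
  obtain \<epsilon>0 where \<epsilon>0: "\<epsilon>0 > 0" "\<And>v v'. v \<in> F \<Longrightarrow> v' \<in> F \<Longrightarrow> v \<noteq> v' \<Longrightarrow> ball v \<epsilon>0 \<inter> ball v' \<epsilon>0 = {}"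
  proof -
    have "\<forall>\<^sub>F e in at_right (0::real). \<forall>v\<in>F. \<forall>v'\<in>F. v \<noteq> v' \<longrightarrow> e < dist v v' / 2"
    proof (intro eventually_ball_finite ballI \<open>finite F\<close>)
      fix v v'
      show "\<forall>\<^sub>F e in at_right 0. v \<noteq> v' \<longrightarrow> e < dist v v' / 2"
      proof (cases "v = v'")
        case False
        then have "0 < dist v v' / 2" by simp
        then show ?thesis by (intro eventually_at_rightI[of 0 "dist v v' / 2"]) auto
      qed auto
    qed
    then have "\<forall>\<^sub>F e in at_right (0::real). 0 < e \<and> (\<forall>v\<in>F. \<forall>v'\<in>F. v \<noteq> v' \<longrightarrow> e < dist v v' / 2)"
      using eventually_at_right_less[of 0] by (rule eventually_elim2) auto
    from eventually_happens'[OF trivial_limit_at_right_real this]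
    obtain e where e: "e > 0" "\<forall>v\<in>F. \<forall>v'\<in>F. v \<noteq> v' \<longrightarrow> e < dist v v' / 2"
      by (elim exE conjE)
    show thesis
    proof (rule that[OF e(1)])
      fix v v' assume *: "v \<in> F" "v' \<in> F" "v \<noteq> v'"
      then have "e + e \<le> dist v v'" using e(2) by force
      then show "ball v e \<inter> ball v' e = {}" by (rule disjoint_ballI)
    qed
  qed
  obtain \<eta>0 where \<eta>0: "\<eta>0 > 0" "\<And>t. t \<in> {0<..<1} \<Longrightarrow> dist t c < \<eta>0 \<Longrightarrow> \<exists>v\<in>F. \<gamma> t \<in> ball v \<epsilon>0"
    using near[OF \<epsilon>0(1)] by blast
  define J where "J = {0<..<1} \<inter> ball c \<eta>0"
  have "connected (\<gamma> ` J)"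
    unfolding J_def
    by (intro connected_continuous_image continuous_on_subset[OF cont] convex_connected convex_Int) auto
  have J: "\<exists>v\<in>F. \<gamma> t \<in> ball v \<epsilon>0" if "t \<in> J" for t
    using \<eta>0(2)[of t] that by (auto simp: J_def dist_commute)
  \<comment> \<open>The absolute value covers both ends: with x the minimum, the witness is x for c
    = 0 and 1 - x for c = 1.\<close>
  have "\<exists>t0. t0 \<in> J"
    using \<eta>0(1) c by (intro exI[of _ "\<bar>c - min (\<eta>0/2) (1/2)\<bar>"]) (auto simp: J_def dist_real_def)
  then obtain t0 v where v: "t0 \<in> J" "v \<in> F" "\<gamma> t0 \<in> ball v \<epsilon>0"
    using J by blast
  have inv: "\<gamma> t \<in> ball v \<epsilon>0" if "t \<in> J" for t
  proof -
    let ?V = "\<Union>v'\<in>F - {v}. ball v' \<epsilon>0"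
    have "ball v \<epsilon>0 \<inter> ?V = {}" using \<epsilon>0(2)[OF v(2)] by blast
    moreover have "\<gamma> ` J \<subseteq> ball v \<epsilon>0 \<union> ?V" using J by blast
    moreover have "open ?V" by auto
    ultimately have "ball v \<epsilon>0 \<inter> \<gamma> ` J = {} \<or> ?V \<inter> \<gamma> ` J = {}"
      using connectedD[OF \<open>connected (\<gamma> ` J)\<close> open_ball] by (metis inf_bot_left)
    then show ?thesis
      using v(1,3) \<open>\<gamma> ` J \<subseteq> ball v \<epsilon>0 \<union> ?V\<close> that by blast
  qed
  have "(\<gamma> \<longlongrightarrow> v) (at c within {0<..<1})"
  proof (rule tendstoI)
    fix e :: real assume "e > 0"
    then have "min e \<epsilon>0 > 0" using \<epsilon>0 by simp
    from near[OF this] obtain \<eta> where \<eta>: "\<eta> > 0"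
      "\<And>t. t \<in> {0<..<1} \<Longrightarrow> dist t c < \<eta> \<Longrightarrow> \<exists>v\<in>F. \<gamma> t \<in> ball v (min e \<epsilon>0)" by blast
    show "\<forall>\<^sub>F t in at c within {0<..<1}. dist (\<gamma> t) v < e"
      unfolding eventually_at
    proof (intro exI conjI ballI impI)
      show "0 < min \<eta> \<eta>0" using \<eta> \<eta>0 by simp
      fix t assume t: "t \<in> {0<..<1}" "t \<noteq> c \<and> dist t c < min \<eta> \<eta>0"
      then obtain v' where v': "v' \<in> F" "\<gamma> t \<in> ball v' (min e \<epsilon>0)" using \<eta>(2) by auto
      have "\<gamma> t \<in> ball v \<epsilon>0" using inv t by (auto simp: J_def dist_commute)
      then have "v' = v" using \<epsilon>0(2)[OF v(2) v'(1)] v'(2) by fastforce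
      then show "dist (\<gamma> t) v < e" using v'(2) by (simp add: dist_commute)
    qed
  qed
  then show ?thesis by blast
qed

text \<open>There is one lift through each point over the base point 1/2. Lifts that agree anywhere
  agree at 1/2 by uniqueness, and so belong to the same point.\<close>

lemma open_arcs:
  obtains \<gamma> :: "nat \<Rightarrow> real \<Rightarrow> complex" where
    "\<And>i. i < degree p \<Longrightarrow> continuous_on {0<..<1} (\<gamma> i)"
    "\<And>i t. i < degree p \<Longrightarrow> t \<in> {0<..<1} \<Longrightarrow> poly p (\<gamma> i t) = of_real t * poly q (\<gamma> i t)"
    "\<And>i j t. i < degree p \<Longrightarrow> j < degree p \<Longrightarrow> t \<in> {0<..<1} \<Longrightarrow> \<gamma> i t = \<gamma> j t \<Longrightarrow> i = j"
proof -
  have cov: "covering_space (S \<inter> f -` (- {0,1})) f (- {0,1})"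
    by (intro covering open_Compl finite_imp_closed) auto
  have "card {z \<in> S. f z = 1/2} = degree p" by (intro fibre_card) auto
  then obtain a where a: "bij_betw a {0..<degree p} {z \<in> S. f z = 1/2}"
    using ex_bij_betw_nat_finite[of "{z \<in> S. f z = 1/2}"] degree_less card.infinite by fastforce
  have "\<exists>g. continuous_on {0<..<1} g \<and> g \<in> {0<..<1} \<rightarrow> S \<inter> f -` (- {0,1}) \<and> g (1/2) = a i
        \<and> (\<forall>t\<in>{0<..<1}. f (g t) = of_real t)" if "i < degree p" for i
  proof -
    have "a i \<in> S" "f (a i) = 1/2" using a that by (auto simp: bij_betw_def)
    then have "a i \<in> S \<inter> f -` (- {0,1})" by auto
    moreover have "of_real \<in> {0<..<1::real} \<rightarrow> - {0, 1 :: complex}" by auto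
    moreover have "continuous_on {0<..<1::real} complex_of_real" by (intro continuous_intros)
    moreover have "simply_connected {0<..<1::real}" "locally path_connected {0<..<1::real}"
      by (simp_all add: convex_imp_simply_connected convex_imp_locally_path_connected)
    moreover have "1/2 \<in> {0<..<1::real}" "complex_of_real (1/2) = f (a i)"
      using \<open>f (a i) = 1/2\<close> by auto
    ultimately obtain g where "continuous_on {0<..<1} g" "g \<in> {0<..<1} \<rightarrow> S \<inter> f -` (- {0,1})" "g (1/2) = a i"
        "\<And>t. t \<in> {0<..<1} \<Longrightarrow> f (g t) = complex_of_real t"
      using covering_space_lift_strong[OF cov] by metis
    then show ?thesis by blast
  qed
  then obtain \<gamma> where \<gamma>: "\<And>i. i < degree p \<Longrightarrow> continuous_on {0<..<1} (\<gamma> i)"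
    "\<And>i. i < degree p \<Longrightarrow> \<gamma> i \<in> {0<..<1} \<rightarrow> S \<inter> f -` (- {0,1})"
    "\<And>i. i < degree p \<Longrightarrow> \<gamma> i (1/2) = a i"
    "\<And>i t. i < degree p \<Longrightarrow> t \<in> {0<..<1} \<Longrightarrow> f (\<gamma> i t) = of_real t"
    by metis
  show thesis
  proof (rule that[OF \<gamma>(1)])
    show "poly p (\<gamma> i t) = of_real t * poly q (\<gamma> i t)" if "i < degree p" "t \<in> {0<..<1}" for i t
      using \<gamma>(2,4) that f_eq_iff[of "\<gamma> i t" "of_real t"] by (auto simp: Pi_iff)
    show "i = j" if ij: "i < degree p" "j < degree p" "t \<in> {0<..<1}" "\<gamma> i t = \<gamma> j t" for i j t
    proof -
      have "\<gamma> i (1/2) = \<gamma> j (1/2)"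
        by (rule covering_space_lift_unique[OF cov ij(4) _ _ \<gamma>(1)[OF ij(1)] \<gamma>(2)[OF ij(1)] _ \<gamma>(1)[OF ij(2)] \<gamma>(2)[OF ij(2)],
            where f = complex_of_real])
          (use \<gamma>(4) ij in \<open>auto intro!: continuous_intros\<close>)
      then show "i = j" using \<gamma>(3) ij a by (auto simp: bij_betw_def inj_on_def)
    qed
  qed
qed

text \<open>Inside the interval the roots are simple and are exactly the values of the lifts. The
  ends of different arcs may coincide, hence injectivity only for \<open>0 < t < 1\<close>; the
  factorisation at the ends records how often they do.\<close>

lemma closed_arcs:
  obtains g :: "nat \<Rightarrow> real \<Rightarrow> complex" where
    "\<And>i. i < degree p \<Longrightarrow> continuous_on {0..1} (g i)"
    "\<And>i j t. i < degree p \<Longrightarrow> j < degree p \<Longrightarrow> 0 < t \<Longrightarrow> t < 1 \<Longrightarrow> g i t = g j t \<Longrightarrow> i = j"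
    "\<And>t. t \<in> {0..1} \<Longrightarrow> p - smult (of_real t) q = smult (lead_coeff p) (\<Prod>i<degree p. [:- g i t, 1:])"
proof -
  obtain \<gamma> :: "nat \<Rightarrow> real \<Rightarrow> complex" where \<gamma>:
    "\<And>i. i < degree p \<Longrightarrow> continuous_on {0<..<1} (\<gamma> i)"
    "\<And>i t. i < degree p \<Longrightarrow> t \<in> {0<..<1} \<Longrightarrow> poly p (\<gamma> i t) = of_real t * poly q (\<gamma> i t)"
    "\<And>i j t. i < degree p \<Longrightarrow> j < degree p \<Longrightarrow> t \<in> {0<..<1} \<Longrightarrow> \<gamma> i t = \<gamma> j t \<Longrightarrow> i = j"
    using open_arcs by blast
  have "\<forall>i c. \<exists>l. i < degree p \<and> (c = 0 \<or> c = 1) \<longrightarrow> (\<gamma> i \<longlongrightarrow> l) (at c within {0<..<1})"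
    using lift_endpoint_limit[OF \<gamma>(1,2)] by blast
  then obtain L where L: "\<And>i c. i < degree p \<Longrightarrow> c = 0 \<or> c = 1 \<Longrightarrow> (\<gamma> i \<longlongrightarrow> L i c) (at c within {0<..<1})"
    by metis
  define g where "g i t = (if t \<in> {0<..<1} then \<gamma> i t else L i t)" for i t
  have g_in: "g i t = \<gamma> i t" if "t \<in> {0<..<1}" for i t using that by (simp add: g_def)
  have cont_g: "continuous_on {0..1} (g i)" if "i < degree p" for i
  proof (rule continuous_on_IccI)
    have "(g i \<longlongrightarrow> L i c) (at c within {0<..<1})" if "c = 0 \<or> c = 1" for c
      using L[OF \<open>i < degree p\<close> that]
      by (rule Lim_transform_eventually) (auto simp: eventually_at g_in intro!: exI[of _ 1])
    then show "(g i \<longlongrightarrow> g i 0) (at_right 0)" "(g i \<longlongrightarrow> g i 1) (at_left 1)"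
      using at_within_nhd[of 0 "{..<1::real}" "{0<..<1}" "{0<..}"] at_within_nhd[of 1 "{0::real<..}" "{0<..<1}" "{..<1}"]
      by (force simp: g_def)+
    fix t :: real assume t: "0 < t" "t < 1"
    have "continuous_on {0<..<1} (g i)"
      using \<gamma>(1)[OF that] by (rule continuous_on_eq) (simp add: g_in)
    then show "g i \<midarrow>t\<rightarrow> g i t"
      using t by (simp add: continuous_on_eq_continuous_at isCont_def)
  qed auto
  have inner: "p - smult (of_real t) q = smult (lead_coeff p) (\<Prod>i<degree p. [:- g i t, 1:])"
    if t: "t \<in> {0<..<1}" for t
  proof -
    let ?P = "p - smult (complex_of_real t) q"
    have t': "complex_of_real t \<noteq> 0" "complex_of_real t \<noteq> 1" using t by auto
    have "rsquarefree ?P"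
      unfolding rsquarefree_roots using unramified[OF t'] by (auto simp: pderiv_diff pderiv_smult)
    note 1 = complex_poly_decompose_rsquarefree[OF this]
    have "degree ?P = degree p"
      using degree_less degree_smult_le[of "of_real t" q]
        degree_add_eq_left[of "- smult (of_real t) q" p] by simp
    then have lc: "lead_coeff ?P = lead_coeff p"
      using degree_less by (simp add: coeff_eq_0)
    have inj: "inj_on (\<lambda>i. g i t) {..<degree p}"
      using \<gamma>(3) t by (auto simp: inj_on_def g_in)
    have "{z \<in> S. f z = of_real t} = {z. poly ?P z = 0}" using f_eq_iff by auto
    then have c: "card {z. poly ?P z = 0} = degree p" using fibre_card[OF t'] by simp
    have "(\<lambda>i. g i t) ` {..<degree p} = {z. poly ?P z = 0}"
    proof (rule card_subset_eq)
      show "finite {z. poly ?P z = 0}" using c degree_less card.infinite by fastforce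
      show "(\<lambda>i. g i t) ` {..<degree p} \<subseteq> {z. poly ?P z = 0}" using \<gamma>(2) t by (auto simp: g_in)
      show "card ((\<lambda>i. g i t) ` {..<degree p}) = card {z. poly ?P z = 0}"
        using inj c by (simp add: card_image)
    qed
    then have "(\<Prod>z|poly ?P z = 0. [:-z, 1:]) = (\<Prod>i<degree p. [:- g i t, 1:])"
      using prod.reindex[OF inj, of "\<lambda>z. [:-z, 1:]"] by simp
    then show ?thesis using 1 lc by simp
  qed
  show thesis
  proof (rule that[OF cont_g])
    show "i = j" if "i < degree p" "j < degree p" "0 < t" "t < 1" "g i t = g j t" for i j t
      using \<gamma>(3)[of i j t] that by (simp add: g_in)
    fix t :: real assume t: "t \<in> {0..1}"
    show "p - smult (of_real t) q = smult (lead_coeff p) (\<Prod>i<degree p. [:- g i t, 1:])"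
    proof (rule poly_ext)
      fix z
      \<comment> \<open>At a fixed z the difference of the two sides is continuous in t and vanishes
        on the dense open interval.\<close>
      define h where "h t = poly (p - smult (complex_of_real t) q) z
        - poly (smult (lead_coeff p) (\<Prod>i<degree p. [:- g i t, 1:])) z" for t
      have "continuous_on {0..1} h"
        unfolding h_def by (auto simp: poly_prod intro!: continuous_intros cont_g)
      moreover have "h s = 0" if "s \<in> {0<..<1}" for s using inner[OF that] by (simp add: h_def)
      moreover have "{0..1::real} = closure {0<..<1}" by simp
      ultimately have "h t = 0"
        using t continuous_constant_on_closure[of "{0<..<1}" h 0 t] by metis
      then show "poly (p - smult (of_real t) q) z = poly (smult (lead_coeff p) (\<Prod>i<degree p. [:- g i t, 1:])) z"
        by (simp add: h_def)
    qed
  qed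
qed

end

section \<open>Ramification indices and lifted arcs on the projective line\<close>

lemma P1_map_Some_iff:
  "P1_map p q (Some z) = Some c \<longleftrightarrow> poly q z \<noteq> 0 \<and> poly p z = c * poly q z"
  by (auto simp: P1_map_def field_simps)

lemma ram_index_Some:
  assumes "P1_map p q (Some z) = Some c"
  shows "ram_index p q (Some z) = order z (p - smult c q)"
proof -
  have "order z q = 0" using assms by (auto simp: P1_map_Some_iff intro: order_0I)
  then show ?thesis using assms by (simp add: ram_index_def ord_at_def)
qed

text \<open>Applied to the factorisation at t = 0 or t = 1, this reads a ramification index as a
  number of arc ends.\<close>

lemma order_prod_linear:
  "order z (\<Prod>i<n::nat. [:- a i, 1:]) = card {i. i < n \<and> a i = z}" for z :: "'a::idom"
proof (induction n)
  case (Suc n)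
  have "{i. i < Suc n \<and> a i = z} = {i. i < n \<and> a i = z} \<union> (if a n = z then {n} else {})"
    by (auto simp: less_Suc_eq)
  moreover have "order z [:- a n, 1:] = (if a n = z then 1 else 0)"
    using order_power_n_n[of z 1] by (auto intro: order_0I)
  moreover have nz: "(\<Prod>i<n. [:- a i, 1:]) \<noteq> 0" by simp
  have "order z (\<Prod>i<Suc n. [:- a i, 1:]) = order z (\<Prod>i<n. [:- a i, 1:]) + order z [:- a n, 1:]"
    unfolding prod.lessThan_Suc by (rule order_mult) (use nz in \<open>simp only: mult_eq_0_iff; simp\<close>)
  ultimately show ?case
    using Suc by (simp del: prod.lessThan_Suc)
qed (simp add: order_0I)

text \<open>This is all that the combinatorial part takes from analysis. It speaks of the original p
  and q on the projective line, so the choice of coordinate is forgotten. By \<open>lift\<close>,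
  arcs are parametrised by the value of the map.\<close>

locale dessin_arcs =
  fixes p q :: "complex poly" and d :: nat and g :: "nat \<Rightarrow> real \<Rightarrow> P1"
  assumes cont: "i < d \<Longrightarrow> continuous_map (top_of_set {0..1}) P1_top (g i)"
    and lift: "i < d \<Longrightarrow> t \<in> {0..1} \<Longrightarrow> P1_map p q (g i t) = Some (of_real t)"
    and full: "t \<in> {0..1} \<Longrightarrow> P1_map p q x = Some (of_real t) \<Longrightarrow> \<exists>i<d. x = g i t"
    and inj: "i < d \<Longrightarrow> j < d \<Longrightarrow> 0 < t \<Longrightarrow> t < 1 \<Longrightarrow> g i t = g j t \<Longrightarrow> i = j"
    and ram: "t = 0 \<or> t = 1 \<Longrightarrow> P1_map p q x = Some (of_real t) \<Longrightarrow>
          card {i. i < d \<and> g i t = x} = ram_index p q x"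
    and connected: "connectedin P1_top {x. \<exists>t\<in>{0..1::real}. P1_map p q x = Some (of_real t)}"

text \<open>\<open>m\<close> is a coordinate in which the map has a pole at infinity. Its range may
  omit only poles, so nothing above the segment is lost.\<close>

lemma dessin_arcs_via_chart:
  assumes belyi: "belyi_map p q"
    and "degree q' < degree p'" and "\<And>z. poly p' z = 0 \<Longrightarrow> poly q' z \<noteq> 0"
    and m: "continuous_map euclidean P1_top m" "inj m"
    and map_m: "\<And>z. P1_map p q (m z) = P1_map p' q' (Some z)"
    and ram_m: "\<And>z. P1_map p' q' (Some z) \<noteq> None \<Longrightarrow> ram_index p q (m z) = ram_index p' q' (Some z)"
    and range_m: "\<And>x. P1_map p q x \<noteq> None \<Longrightarrow> x \<in> range m"
  shows "\<exists>g. dessin_arcs p q (degree p') g"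
proof -
  interpret finite_part_cover p' q'
  proof
    \<comment> \<open>A multiple root of \<open>p' - smult t q'\<close> would be a ramification
      point above t, which is neither 0 nor 1 and is finite.\<close>
    fix t z assume t: "t \<noteq> 0" "t \<noteq> 1" and z: "poly p' z = t * poly q' z"
    let ?P = "p' - smult t q'"
    have "poly q' z \<noteq> 0" using z assms(3)[of z] by auto
    then have fz: "P1_map p' q' (Some z) = Some t" using z by (simp add: P1_map_Some_iff)
    have "degree ?P = degree p'"
      using assms(2) degree_smult_le[of t q'] degree_add_eq_left[of "- smult t q'" p'] by simp
    then have "degree ?P \<noteq> 0" using assms(2) by simp
    then have "?P \<noteq> 0" "pderiv ?P \<noteq> 0" by (metis degree_0) (simp only: pderiv_eq_0_iff \<open>degree ?P \<noteq> 0\<close>, simp)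
    show "poly (pderiv p') z \<noteq> t * poly (pderiv q') z"
    proof
      assume "poly (pderiv p') z = t * poly (pderiv q') z"
      then have "poly (pderiv ?P) z = 0" by (simp add: pderiv_diff pderiv_smult)
      then have "order z (pderiv ?P) \<noteq> 0" using \<open>pderiv ?P \<noteq> 0\<close> order_root by blast
      moreover have "order z ?P \<noteq> 0" using z \<open>?P \<noteq> 0\<close> order_root[of ?P z] by simp
      ultimately have "order z ?P > 1" using order_pderiv[OF \<open>?P \<noteq> 0\<close>, of z] z by simp
      then have "ram_index p q (m z) > 1" using ram_m[of z] ram_index_Some[OF fz] fz by simp
      then have "P1_map p q (m z) \<in> {Some 0, Some 1, None}" using belyi by (simp add: belyi_map_def)
      then show False using fz t map_m by simp
    qed
  qed (use assms in auto)
  obtain \<gamma> where \<gamma>: "\<And>i. i < degree p' \<Longrightarrow> continuous_on {0..1} (\<gamma> i)"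
    "\<And>i j t. i < degree p' \<Longrightarrow> j < degree p' \<Longrightarrow> 0 < t \<Longrightarrow> t < 1 \<Longrightarrow> \<gamma> i t = \<gamma> j t \<Longrightarrow> i = j"
    "\<And>t. t \<in> {0..1} \<Longrightarrow> p' - smult (of_real t) q' = smult (lead_coeff p') (\<Prod>i<degree p'. [:- \<gamma> i t, 1:])"
    using closed_arcs by blast
  have map_Some: "P1_map p q (m z) = Some t \<longleftrightarrow> poly p' z = t * poly q' z" for z t
    using f_eq_iff[of z t] map_m by (auto simp: P1_map_Some_iff S_def)
  have root: "poly p' z = of_real t * poly q' z \<longleftrightarrow> (\<exists>i<degree p'. z = \<gamma> i t)" if "t \<in> {0..1}" for z t
  proof -
    have "poly (p' - smult (of_real t) q') z = lead_coeff p' * (\<Prod>i<degree p'. z - \<gamma> i t)"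
      by (simp only: \<gamma>(3)[OF that]) (simp add: poly_prod)
    moreover have "poly p' z = of_real t * poly q' z \<longleftrightarrow> poly (p' - smult (of_real t) q') z = 0"
      by simp
    ultimately have "poly p' z = of_real t * poly q' z \<longleftrightarrow> (\<Prod>i<degree p'. z - \<gamma> i t) = 0"
      using p_nonzero by (simp del: poly_diff poly_smult prod_zero_iff)
    then show ?thesis by auto
  qed
  have "dessin_arcs p q (degree p') (\<lambda>i t. m (\<gamma> i t))"
  proof
    show "continuous_map (top_of_set {0..1}) P1_top (\<lambda>t. m (\<gamma> i t))" if "i < degree p'" for i
      using continuous_map_compose[OF _ m(1), of "top_of_set {0..1}" "\<gamma> i"] \<gamma>(1)[OF that]
      by (simp add: o_def)
    show "P1_map p q (m (\<gamma> i t)) = Some (of_real t)" if "i < degree p'" "t \<in> {0..1}" for i t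
      using root[OF that(2)] that(1) map_Some by blast
    show "\<exists>i<degree p'. x = m (\<gamma> i t)" if "t \<in> {0..1}" "P1_map p q x = Some (of_real t)" for t x
      using root[OF that(1)] range_m[of x] that(2) map_Some by (auto simp: image_iff)
    show "i = j" if "i < degree p'" "j < degree p'" "0 < t" "t < 1" "m (\<gamma> i t) = m (\<gamma> j t)" for i j t
      using \<gamma>(2) that m(2) by (auto dest: injD)
    show "card {i. i < degree p' \<and> m (\<gamma> i t) = x} = ram_index p q x"
      if t: "t = 0 \<or> t = 1" and x: "P1_map p q x = Some (of_real t)" for t x
    proof -
      obtain z where z: "x = m z" using range_m[of x] x by auto
      have t': "t \<in> {0..1}" using t by auto
      have *: "P1_map p' q' (Some z) = Some (of_real t)" using x z map_m by simp
      have "ram_index p q x = order z (p' - smult (of_real t) q')"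
        using ram_m[of z] ram_index_Some[OF *] * z by simp
      also have "\<dots> = order z (\<Prod>i<degree p'. [:- \<gamma> i t, 1:])"
        unfolding \<gamma>(3)[OF t'] using p_nonzero by (simp add: order_smult)
      also have "\<dots> = card {i. i < degree p' \<and> \<gamma> i t = z}" by (rule order_prod_linear)
      also have "{i. i < degree p' \<and> \<gamma> i t = z} = {i. i < degree p' \<and> m (\<gamma> i t) = x}"
        using z m(2) by (auto dest: injD)
      finally show ?thesis by simp
    qed
    have "{x. \<exists>t\<in>{0..1::real}. P1_map p q x = Some (of_real t)} = m ` (S \<inter> f -` closed_segment 0 1)"
    proof (intro set_eqI iffI)
      fix x assume "x \<in> {x. \<exists>t\<in>{0..1::real}. P1_map p q x = Some (of_real t)}"
      then obtain t :: real where t: "t \<in> {0..1}" "P1_map p q x = Some (of_real t)" by blast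
      then obtain z where z: "x = m z" using range_m[of x] by auto
      have "z \<in> S \<and> f z = of_real t" using t z map_Some f_eq_iff by blast
      then show "x \<in> m ` (S \<inter> f -` closed_segment 0 1)"
        using z t by (auto simp: closed_segment_def scaleR_conv_of_real)
    next
      fix x assume "x \<in> m ` (S \<inter> f -` closed_segment 0 1)"
      then obtain z t where z: "x = m z" "z \<in> S" "f z = of_real t" "t \<in> {0..1::real}"
        by (auto simp: closed_segment_def scaleR_conv_of_real)
      then have "P1_map p q x = Some (of_real t)" using map_Some f_eq_iff by blast
      then show "x \<in> {x. \<exists>t\<in>{0..1::real}. P1_map p q x = Some (of_real t)}" using z(4) by blast
    qed
    then show "connectedin P1_top {x. \<exists>t\<in>{0..1::real}. P1_map p q x = Some (of_real t)}"
      using connectedin_continuous_map_image[OF m(1)] connected_preimage_segment by simp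
  qed
  then show ?thesis by blast
qed

section \<open>Moving a pole to infinity by inversion\<close>

definition pole_chart :: "complex \<Rightarrow> complex \<Rightarrow> P1" where
  "pole_chart a z = (if z = 0 then None else Some (a + 1 / z))"

text \<open>Only continuity at z = 0, which goes to infinity, needs an estimate: a basic
  neighbourhood of infinity omits a compact set of some radius R, and \<open>a + 1 / z\<close> lies
  outside that radius once \<open>norm z < 1 / (R + norm a)\<close>.\<close>

lemma continuous_map_pole_chart: "continuous_map euclidean P1_top (pole_chart a)"
  unfolding continuous_map_def
proof (intro conjI allI impI)
  show "pole_chart a \<in> topspace euclidean \<rightarrow> topspace P1_top"
    by (auto simp: P1_top_def pole_chart_def)
  have op: "open (- {0} \<inter> (\<lambda>z. a + 1 / z) -` U)" if "open U" for U
    using that by (intro continuous_open_preimage continuous_intros) auto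
  fix V assume "openin P1_top V"
  then consider U where "open U" "V = Some ` U" | C where "compact C" "V = insert None (Some ` (- C))"
    by (auto simp: P1_top_def openin_Alexandroff_compactification Compl_eq_Diff_UNIV)
  then show "openin euclidean {x \<in> topspace euclidean. pole_chart a x \<in> V}"
  proof cases
    case 1
    then have "{x. pole_chart a x \<in> V} = - {0} \<inter> (\<lambda>z. a + 1 / z) -` U"
      by (auto simp: pole_chart_def)
    then show ?thesis using op[OF 1(1)] by simp
  next
    case 2
    obtain R where R: "R > 0" "\<And>y. y \<in> C \<Longrightarrow> norm y \<le> R"
      using compact_imp_bounded[OF 2(1)] bounded_pos by metis
    define e where "e = 1 / (R + norm a)"
    have "e > 0" using R by (simp add: e_def add_pos_nonneg)
    have "a + 1 / z \<notin> C" if "z \<noteq> 0" "norm z < e" for z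
    proof
      assume "a + 1 / z \<in> C"
      then have "norm (a + 1 / z) \<le> R" by (rule R)
      then have "norm (1 / z) \<le> R + norm a"
        using norm_triangle_ineq4[of "a + 1 / z" a] by simp
      moreover have "R + norm a < 1 / norm z"
        using that R by (simp add: e_def field_simps add_pos_nonneg)
      ultimately show False by (simp add: norm_divide)
    qed
    then have "{x. pole_chart a x \<in> V} = (- {0} \<inter> (\<lambda>z. a + 1 / z) -` (- C)) \<union> ball 0 e"
      using 2 \<open>e > 0\<close> by (auto simp: pole_chart_def)
    then show ?thesis using op[of "- C"] compact_imp_closed[OF 2(1)] by auto
  qed
qed

lemma inj_pole_chart: "inj (pole_chart a)"
  by (auto simp: inj_def pole_chart_def split: if_splits)

text \<open>This is \<open>z ^ n * r (a + 1 / z)\<close>: the Taylor coefficients of r at a in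
  reverse order. The exponent n is explicit because p and q must be transformed with the same one to
  keep their quotient.\<close>

definition inversion_poly :: "complex \<Rightarrow> nat \<Rightarrow> complex poly \<Rightarrow> complex poly" where
  "inversion_poly a n r = (\<Sum>k\<le>n. monom (coeff (r \<circ>\<^sub>p [:a, 1:]) k) (n - k))"

lemma poly_inversion_poly:
  assumes "degree r \<le> n" "z \<noteq> 0"
  shows "poly (inversion_poly a n r) z = z ^ n * poly r (a + 1 / z)"
proof -
  let ?s = "r \<circ>\<^sub>p [:a, 1:]"
  have "degree ?s \<le> n" using assms by (simp add: degree_pcompose)
  then have "poly ?s (1 / z) = poly (\<Sum>k\<le>n. monom (coeff ?s k) k) (1 / z)"
    by (simp add: poly_as_sum_of_monoms')
  moreover have "poly ?s (1 / z) = poly r (a + 1 / z)" by (simp add: poly_pcompose)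
  moreover have "poly (\<Sum>k\<le>n. monom (coeff ?s k) k) (1 / z) = (\<Sum>k\<le>n. coeff ?s k * (1 / z) ^ k)"
    by (simp add: poly_sum poly_monom)
  moreover have "poly (inversion_poly a n r) z = (\<Sum>k\<le>n. z ^ n * (coeff ?s k * (1 / z) ^ k))"
    unfolding inversion_poly_def poly_sum poly_monom
    using assms(2) by (intro sum.cong) (auto simp: power_diff power_divide)
  ultimately show ?thesis by (simp add: sum_distrib_left)
qed

text \<open>The constant term comes from index n, whose coefficient is unchanged by the shift by a.
  It is the coefficient that \<open>P1_map\<close> uses at infinity.\<close>

lemma poly_inversion_poly_0:
  assumes "degree r \<le> n"
  shows "poly (inversion_poly a n r) 0 = coeff r n"
proof -
  have "coeff (r \<circ>\<^sub>p [:a, 1:]) n = coeff r n"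
  proof (cases "degree r = n")
    case True
    then show ?thesis using lead_coeff_comp[of "[:a, 1:]" r] by (simp add: degree_pcompose)
  next
    case False
    then show ?thesis using assms by (simp add: coeff_eq_0 degree_pcompose)
  qed
  moreover have "poly (inversion_poly a n r) 0 = (\<Sum>k\<le>n. if k = n then coeff (r \<circ>\<^sub>p [:a, 1:]) k else 0)"
    unfolding inversion_poly_def poly_sum by (intro sum.cong) (auto simp: poly_monom power_0_left)
  ultimately show ?thesis by simp
qed

lemma degree_inversion_poly: "degree (inversion_poly a n r) \<le> n"
  unfolding inversion_poly_def
  by (intro degree_sum_le) (auto intro: order_trans[OF degree_monom_le])

text \<open>This decides the degrees after inversion: if a is a zero of q and not of p, the
  transform of p keeps degree n and that of q drops below it.\<close>

lemma coeff_inversion_poly: "coeff (inversion_poly a n r) n = poly r a"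
proof -
  have "coeff (inversion_poly a n r) n = (\<Sum>k\<le>n. if k = 0 then coeff (r \<circ>\<^sub>p [:a, 1:]) k else 0)"
    unfolding inversion_poly_def coeff_sum by (intro sum.cong) auto
  also have "\<dots> = poly (r \<circ>\<^sub>p [:a, 1:]) 0" by (simp add: poly_0_coeff_0)
  finally show ?thesis by (simp add: poly_pcompose)
qed

text \<open>It lets identities between inversion polynomials be checked where the formula with
  \<open>a + 1 / z\<close> makes sense.\<close>

lemma poly_eqI_nonzero:
  fixes P Q :: "complex poly"
  assumes "\<And>z. z \<noteq> 0 \<Longrightarrow> poly P z = poly Q z"
  shows "P = Q"
proof (rule ccontr)
  assume "P \<noteq> Q"
  then have "finite {z. poly (P - Q) z = 0}" by (intro poly_roots_finite) simp
  moreover have "- {0} \<subseteq> {z. poly (P - Q) z = 0}" using assms by auto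
  ultimately have "finite (- {0 :: complex})" using finite_subset by blast
  then show False using infinite_UNIV_char_0[where 'a = complex] by (simp add: finite_compl)
qed

lemma inversion_poly_diff_smult:
  assumes "degree r \<le> n" "degree s \<le> n"
  shows "inversion_poly a n (r - smult c s) = inversion_poly a n r - smult c (inversion_poly a n s)"
proof (rule poly_eqI_nonzero)
  fix z :: complex assume "z \<noteq> 0"
  moreover have "degree (r - smult c s) \<le> n"
    using assms degree_smult_le[of c s] by (intro degree_diff_le) auto
  ultimately show "poly (inversion_poly a n (r - smult c s)) z
      = poly (inversion_poly a n r - smult c (inversion_poly a n s)) z"
    using assms by (simp add: poly_inversion_poly algebra_simps)
qed

text \<open>With \<open>x = a + 1 / z\<close>, the identity
  \<open>w * (a + 1 / w - x) = (- 1 / z) * (w - z)\<close> turns each factor \<open>X - x\<close> of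
  r into a multiple of \<open>X - z\<close>; the transform of the remaining cofactor does not vanish
  at z.\<close>

lemma order_inversion_poly:
  assumes "r \<noteq> 0" "degree r \<le> n" "z \<noteq> 0"
  shows "order z (inversion_poly a n r) = order (a + 1 / z) r"
proof -
  define x where "x = a + 1 / z"
  define k where "k = order x r"
  obtain s where s: "r = [:- x, 1:] ^ k * s" "\<not> [:- x, 1:] dvd s"
    using order_decomp[OF assms(1), of x] by (auto simp: k_def)
  have "s \<noteq> 0" using s assms by auto
  have "degree r = k + degree s" using \<open>s \<noteq> 0\<close> s(1) by (simp add: degree_mult_eq degree_linear_power)
  then have deg: "degree s \<le> n - k" "k \<le> n" using assms by auto
  define c where "c = - 1 / z"
  have eq: "inversion_poly a n r = smult (c ^ k) ([:- z, 1:] ^ k * inversion_poly a (n - k) s)"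
  proof (rule poly_eqI_nonzero)
    fix w :: complex assume w: "w \<noteq> 0"
    have "w ^ n * poly r (a + 1 / w) = (w * (a + 1 / w - x)) ^ k * (w ^ (n - k) * poly s (a + 1 / w))"
      using deg(2) by (simp add: s(1) power_mult_distrib power_add[symmetric] flip: mult.assoc)
    also have "w * (a + 1 / w - x) = c * (w - z)"
      using w assms(3) by (simp add: x_def c_def field_simps)
    finally show "poly (inversion_poly a n r) w
        = poly (smult (c ^ k) ([:- z, 1:] ^ k * inversion_poly a (n - k) s)) w"
      using w deg assms by (simp add: poly_inversion_poly power_mult_distrib)
  qed
  have "poly s x \<noteq> 0" using s(2) by (simp add: poly_eq_0_iff_dvd)
  then have nz: "poly (inversion_poly a (n - k) s) z \<noteq> 0"
    using poly_inversion_poly[OF deg(1) assms(3)] assms(3) by (simp add: x_def)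
  then have "order z ([:- z, 1:] ^ k * inversion_poly a (n - k) s) = k"
    by (subst order_mult) (auto simp: order_power_n_n order_0I)
  then show ?thesis unfolding eq using assms(3) by (simp add: order_smult c_def k_def x_def)
qed

text \<open>The degree that r lacks becomes its order of vanishing at the point that corresponds to
  infinity.\<close>

lemma order_inversion_poly_0:
  assumes "r \<noteq> 0" "degree r \<le> n"
  shows "order 0 (inversion_poly a n r) = n - degree r"
proof -
  let ?k = "n - degree r"
  have eq: "inversion_poly a n r = [:- 0, 1:] ^ ?k * inversion_poly a (degree r) r"
  proof (rule poly_eqI_nonzero)
    fix w :: complex assume "w \<noteq> 0"
    then show "poly (inversion_poly a n r) w = poly ([:- 0, 1:] ^ ?k * inversion_poly a (degree r) r) w"
      using assms(2) by (simp add: poly_inversion_poly flip: power_add mult.assoc)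
  qed
  have nz: "poly (inversion_poly a (degree r) r) 0 \<noteq> 0"
    using assms by (simp add: poly_inversion_poly_0)
  show ?thesis unfolding eq
    by (subst order_mult) (use nz in \<open>auto simp: order_power_n_n order_0I simp del: minus_zero\<close>)
qed

lemma P1_map_pole_chart:
  "P1_map p q (pole_chart a z) = P1_map (inversion_poly a (map_degree p q) p) (inversion_poly a (map_degree p q) q) (Some z)"
proof (cases "z = 0")
  case True
  then show ?thesis by (simp add: P1_map_def pole_chart_def poly_inversion_poly_0 map_degree_def Let_def)
next
  case False
  then show ?thesis by (simp add: P1_map_def pole_chart_def poly_inversion_poly map_degree_def)
qed

lemma ram_index_pole_chart:
  assumes c: "P1_map p q (pole_chart a z) = Some c" and "p \<noteq> smult c q"
  shows "ram_index p q (pole_chart a z)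
    = ram_index (inversion_poly a (map_degree p q) p) (inversion_poly a (map_degree p q) q) (Some z)"
proof -
  let ?n = "map_degree p q" and ?r = "p - smult c q"
  have nz: "?r \<noteq> 0" using assms by simp
  have deg: "degree p \<le> ?n" "degree q \<le> ?n" by (auto simp: map_degree_def)
  have degr: "degree ?r \<le> ?n" using deg degree_smult_le[of c q] by (intro degree_diff_le) auto
  have "ram_index (inversion_poly a ?n p) (inversion_poly a ?n q) (Some z) = order z (inversion_poly a ?n ?r)"
    using c by (simp add: ram_index_Some P1_map_pole_chart inversion_poly_diff_smult deg)
  also have "\<dots> = ram_index p q (pole_chart a z)"
  proof (cases "z = 0")
    case True
    \<comment> \<open>A finite value at infinity forces q to have full degree, so that
      \<open>ord_at\<close> there is \<open>n - degree r\<close>.\<close>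
    then have "coeff q ?n \<noteq> 0" using c by (auto simp: P1_map_def pole_chart_def Let_def split: if_splits)
    then have "degree q = ?n" using deg le_degree by (metis le_antisym)
    then show ?thesis using True c degr order_inversion_poly_0[OF nz degr]
      by (simp add: ram_index_def ord_at_def pole_chart_def)
  next
    case False
    then show ?thesis using c order_inversion_poly[OF nz degr False]
      by (simp add: pole_chart_def ram_index_Some)
  qed
  finally show ?thesis by simp
qed

text \<open>If \<open>degree q < degree p\<close>, infinity is already a pole and
  \<open>Some\<close> is the coordinate. Otherwise q is nonconstant, and any root of it is a finite
  pole to invert at.\<close>

lemma dessin_arcs_exist:
  assumes "belyi_map p q"
  shows "\<exists>g. dessin_arcs p q (map_degree p q) g"
proof -
  have cop: "coprime p q" and pos: "map_degree p q > 0" using assms by (auto simp: belyi_map_def)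
  have no_common: "poly q z \<noteq> 0" if "poly p z = 0" for z
    using cop that by (metis coprime_poly_0)
  show ?thesis
  proof (cases "degree q < degree p")
    case True
    have "\<exists>g. dessin_arcs p q (degree p) g"
    proof (rule dessin_arcs_via_chart[OF assms True no_common])
      show "continuous_map euclidean P1_top Some" unfolding P1_top_def by (rule continuous_map_Some)
      fix x assume "P1_map p q x \<noteq> None"
      then show "x \<in> range Some" using True
        by (cases x) (auto simp: P1_map_def map_degree_def coeff_eq_0)
    qed auto
    then show ?thesis using True by (simp add: map_degree_def max_def)
  next
    case False
    define n where "n = map_degree p q"
    have deg: "degree p \<le> n" "degree q = n" "n > 0" using False pos by (auto simp: n_def map_degree_def)
    obtain a where a: "poly q a = 0"
      using Fundamental_Theorem_Algebra.fundamental_theorem_of_algebra[of q] deg by (auto simp: constant_degree)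
    then have pa: "poly p a \<noteq> 0" using no_common by blast
    let ?p = "inversion_poly a n p" and ?q = "inversion_poly a n q"
    have degp: "degree ?p = n"
      using degree_inversion_poly coeff_inversion_poly pa by (metis le_antisym le_degree)
    have degq: "degree ?q < n"
      using degree_inversion_poly[of a n q] coeff_inversion_poly[of a n q] a deg(3)
      by (metis le_neq_implies_less leading_coeff_0_iff degree_0)
    have nc: "poly ?q z \<noteq> 0" if "poly ?p z = 0" for z
    proof (cases "z = 0")
      case True
      then show ?thesis using deg by (auto simp: poly_inversion_poly_0)
    next
      case False
      then show ?thesis using that no_common deg by (simp add: poly_inversion_poly)
    qed
    have neq: "p \<noteq> smult c q" for c
      using a pa by auto
    have "\<exists>g. dessin_arcs p q (degree ?p) g"
    proof (rule dessin_arcs_via_chart[OF assms _ nc continuous_map_pole_chart inj_pole_chart])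
      show "degree ?q < degree ?p" using degp degq by simp
      show map: "P1_map p q (pole_chart a z) = P1_map ?p ?q (Some z)" for z
        unfolding n_def by (rule P1_map_pole_chart)
      show "ram_index p q (pole_chart a z) = ram_index ?p ?q (Some z)" if "P1_map ?p ?q (Some z) \<noteq> None" for z
        using ram_index_pole_chart[OF _ neq] that map unfolding n_def by (metis option.exhaust)
      fix x assume x: "P1_map p q x \<noteq> None"
      show "x \<in> range (pole_chart a)"
      proof (cases x)
        case None
        then have "x = pole_chart a 0" by (simp add: pole_chart_def)
        then show ?thesis by blast
      next
        case (Some y)
        then have "y \<noteq> a" using x a by (auto simp: P1_map_def)
        then have "x = pole_chart a (1 / (y - a))" using Some by (simp add: pole_chart_def)
        then show ?thesis by blast
      qed
    qed
    then show ?thesis using degp by (simp add: n_def)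
  qed
qed

section \<open>The drawing formed by the arcs\<close>

lemma Hausdorff_P1: "Hausdorff_space P1_top"
  unfolding P1_top_def by (simp add: Hausdorff_space_Alexandroff_compactification locally_compact_space_euclidean)

lemma topspace_P1 [simp]: "topspace P1_top = UNIV"
  unfolding P1_top_def by (auto simp: notin_range_Some UNIV_option_conv)

lemma connectedin_closed_Un:
  assumes "connectedin X (A \<union> B)" "closedin X A" "closedin X B" "A \<inter> B = {}"
  shows "A = {} \<or> B = {}"
proof (rule ccontr)
  assume "\<not> ?thesis"
  then have "\<exists>E1 E2. closedin X E1 \<and> closedin X E2 \<and> A \<union> B \<subseteq> E1 \<union> E2 \<and>
      E1 \<inter> E2 \<inter> (A \<union> B) = {} \<and> E1 \<inter> (A \<union> B) \<noteq> {} \<and> E2 \<inter> (A \<union> B) \<noteq> {}"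
    using assms by (intro exI[of _ A] exI[of _ B]) auto
  then show False using assms(1) by (simp add: connectedin_closedin)
qed

text \<open>The complement of a member is the union of the others, hence open. A connected set that
  meets a member therefore stays inside it.\<close>

lemma connected_components_of_clopen_partition:
  assumes "\<And>C. C \<in> \<C> \<Longrightarrow> connectedin X C \<and> openin X C \<and> C \<noteq> {}" and "\<Union>\<C> = topspace X" and "pairwise disjnt \<C>"
  shows "connected_components_of X = \<C>"
proof -
  have comp: "C \<in> connected_components_of X" if C: "C \<in> \<C>" for C
  proof -
    obtain x where x: "x \<in> C" using assms(1)[OF C] by blast
    have "topspace X - C = \<Union>(\<C> - {C})"
    proof
      show "\<Union>(\<C> - {C}) \<subseteq> topspace X - C"
        using assms(2,3) C by (fastforce simp: pairwise_def disjnt_def)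
    qed (use assms(2) in auto)
    then have "openin X (topspace X - C)" using assms(1) by (auto intro: openin_Union)
    then have "closedin X C" using assms(1)[OF C] openin_subset by (metis closedin_def)
    have "D \<subseteq> C" if "x \<in> D" "connectedin X D" for D
      using connectedin_clopen_cases[OF that(2) \<open>closedin X C\<close>] assms(1)[OF C] that(1) x by (auto simp: disjnt_def)
    then have "connected_component_of_set X x = C"
      using assms(1)[OF C] x by (intro connected_component_of_unique) auto
    then show ?thesis
      using x assms(1)[OF C] openin_subset connected_component_in_connected_components_of by (metis subsetD)
  qed
  show ?thesis
  proof
    show "connected_components_of X \<subseteq> \<C>"
    proof
      fix D assume D: "D \<in> connected_components_of X"
      obtain x where x: "x \<in> D" using nonempty_connected_components_of[OF D] by blast
      then have "x \<in> topspace X" using connected_components_of_subset[OF D] by blast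
      then obtain C where "C \<in> \<C>" "x \<in> C" using assms(2) by blast
      then have "C = D" using connected_components_of_overlap[OF comp D] x by blast
      then show "D \<in> \<C>" using \<open>C \<in> \<C>\<close> by simp
    qed
  qed (use comp in blast)
qed

context dessin_arcs begin

abbreviation D :: drawing where "D \<equiv> dessin_of p q"

definition arc :: "nat \<Rightarrow> P1 set" where "arc i = g i ` {0<..<1}"

lemma black_iff: "v \<in> black D \<longleftrightarrow> P1_map p q v = Some 0"
  and white_iff: "v \<in> white D \<longleftrightarrow> P1_map p q v = Some 1"
  by (simp_all add: dessin_of_def)

text \<open>The map itself recovers the parameter from a point. Hence each arc is injective, and two
  arcs can meet only at equal parameters.\<close>

lemma lift_eq: "i < d \<Longrightarrow> j < d \<Longrightarrow> s \<in> {0..1} \<Longrightarrow> t \<in> {0..1} \<Longrightarrow> g i s = g j t \<Longrightarrow> s = t"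
  using lift[of i s] lift[of j t] by simp

lemma start_black: "i < d \<Longrightarrow> g i 0 \<in> black D" and end_white: "i < d \<Longrightarrow> g i 1 \<in> white D"
  using lift[of i 0] lift[of i 1] by (simp_all add: black_iff white_iff)

lemma black_starts: "black D = (\<lambda>i. g i 0) ` {..<d}"
  using start_black full[of 0] by (fastforce simp: black_iff)

lemma white_ends: "white D = (\<lambda>i. g i 1) ` {..<d}"
  using end_white full[of 1] by (fastforce simp: white_iff)

lemma embedding:
  assumes "i < d"
  shows "embedding_map (top_of_set {0..1}) P1_top (g i)"
  using assms cont Hausdorff_P1 lift_eq[OF assms assms]
  by (intro continuous_imp_embedding_map) (auto simp: inj_on_def compact_space_subtopology)

lemma closed_arc: "i < d \<Longrightarrow> closedin P1_top (g i ` {0..1})"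
  using image_compactin[OF _ cont, of "{0..1}" i] Hausdorff_P1
  by (intro compactin_imp_closedin) (auto simp: compactin_subtopology)

lemma connected_arc: "i < d \<Longrightarrow> connectedin P1_top (arc i)"
  using connectedin_continuous_map_image[OF cont, of i "{0<..<1}"]
  by (simp add: arc_def connectedin_subtopology greaterThanLessThan_subseteq_atLeastAtMost_iff)

lemma closed_arc_eq: "g i ` {0..1} = insert (g i 0) (insert (g i 1) (arc i))"
proof -
  have "{0..1} = insert 0 (insert 1 {0<..<1::real})" by auto
  then show ?thesis by (simp add: arc_def)
qed

lemma arc_nonempty: "arc i \<noteq> {}"
  by (simp add: arc_def)

lemma arc_disjoint: "i < d \<Longrightarrow> j < d \<Longrightarrow> i \<noteq> j \<Longrightarrow> arc i \<inter> arc j = {}"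
proof (rule ccontr)
  assume ij: "i < d" "j < d" "i \<noteq> j" "arc i \<inter> arc j \<noteq> {}"
  then obtain s t where st: "s \<in> {0<..<1}" "t \<in> {0<..<1}" "g i s = g j t" unfolding arc_def by blast
  then have "s = t" using ij by (intro lift_eq[of i j]) auto
  then show False using inj[of i j t] ij st by simp
qed

lemma inj_arc: "inj_on arc {..<d}"
  using arc_disjoint arc_nonempty by (force simp: inj_on_def)

definition open_preimage :: "P1 set" where
  "open_preimage = {x. \<exists>t::real. 0 < t \<and> t < 1 \<and> P1_map p q x = Some (complex_of_real t)}"

lemma open_preimage_eq: "open_preimage = (\<Union>i<d. arc i)"
proof
  show "open_preimage \<subseteq> (\<Union>i<d. arc i)"
  proof
    fix x assume "x \<in> open_preimage"
    then obtain t where t: "0 < t" "t < 1" "P1_map p q x = Some (complex_of_real t)"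
      by (auto simp: open_preimage_def)
    then obtain i where "i < d" "x = g i t" using full[of t x] by auto
    moreover have "g i t \<in> arc i" using t by (auto simp: arc_def)
    ultimately show "x \<in> (\<Union>i<d. arc i)" by blast
  qed
  show "(\<Union>i<d. arc i) \<subseteq> open_preimage"
    using lift by (fastforce simp: open_preimage_def arc_def)
qed

lemma closed_arc_Int_open_preimage:
  assumes "i < d"
  shows "g i ` {0..1} \<inter> open_preimage = arc i"
proof -
  have "g i 0 \<notin> open_preimage" "g i 1 \<notin> open_preimage"
    using lift[OF assms, of 0] lift[OF assms, of 1] by (auto simp: open_preimage_def)
  moreover have "arc i \<subseteq> open_preimage" using assms by (auto simp: open_preimage_eq)
  ultimately show ?thesis by (auto simp: closed_arc_eq)
qed

text \<open>A closed arc is compact, hence closed, and meets the open preimage in the open arc.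
  Finitely many disjoint relatively closed arcs are also relatively open, so they are the
  components.\<close>

lemma edges_eq: "edges D = arc ` {..<d}"
proof -
  let ?X = "subtopology P1_top open_preimage"
  have closed: "closedin ?X (arc i)" if "i < d" for i
    using closed_arc[OF that] closed_arc_Int_open_preimage[OF that] by (metis closedin_subtopology)
  have opn: "openin ?X (arc i)" if "i < d" for i
  proof -
    have "closedin ?X (\<Union>j\<in>{..<d} - {i}. arc j)"
      using closed by (intro closedin_Union) auto
    moreover have "open_preimage - (\<Union>j\<in>{..<d} - {i}. arc j) = arc i"
      using that arc_disjoint unfolding open_preimage_eq by blast
    ultimately show ?thesis by (metis openin_diff openin_topspace topspace_P1 topspace_subtopology inf_top_left)
  qed
  have "connected_components_of ?X = arc ` {..<d}"
  proof (rule connected_components_of_clopen_partition)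
    fix C assume "C \<in> arc ` {..<d}"
    then obtain i where i: "i < d" "C = arc i" by auto
    then have "arc i \<subseteq> open_preimage" by (auto simp: open_preimage_eq)
    then show "connectedin ?X C \<and> openin ?X C \<and> C \<noteq> {}"
      using i connected_arc opn arc_nonempty by (simp add: connectedin_subtopology)
  next
    show "\<Union>(arc ` {..<d}) = topspace ?X" by (simp add: open_preimage_eq)
    show "pairwise disjnt (arc ` {..<d})"
      using arc_disjoint by (auto simp: pairwise_def disjnt_def)
  qed
  then show ?thesis by (simp add: dessin_of_def open_preimage_def)
qed

lemma closure_arc:
  assumes "i < d"
  shows "P1_top closure_of (arc i) = g i ` {0..1}"
proof
  show "P1_top closure_of (arc i) \<subseteq> g i ` {0..1}"
    by (rule closure_of_minimal[OF _ closed_arc[OF assms]]) (auto simp: closed_arc_eq)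
  have "g i ` (top_of_set {0..1} closure_of {0<..<1}) \<subseteq> P1_top closure_of (g i ` {0<..<1})"
    using continuous_map_image_closure_subset[OF cont[OF assms]] .
  moreover have "top_of_set {0..1} closure_of {0<..<1::real} = {0..1}"
    by (simp add: closure_of_subtopology Int_absorb1 closure_greaterThanLessThan greaterThanLessThan_subseteq_atLeastAtMost_iff)
  ultimately show "g i ` {0..1} \<subseteq> P1_top closure_of (arc i)" by (simp add: arc_def)
qed

text \<open>A point of a closed arc over 0 can only be its start, and one over 1 only its end, since
  the value equals the parameter.\<close>

lemma edges_at_black: "v \<in> black D \<Longrightarrow> edges_at D v = arc ` {i. i < d \<and> g i 0 = v}"
  and edges_at_white: "v \<in> white D \<Longrightarrow> edges_at D v = arc ` {i. i < d \<and> g i 1 = v}"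
proof -
  have *: "edges_at D v = arc ` {i. i < d \<and> v \<in> g i ` {0..1}}" for v
    by (auto simp: edges_at_def edges_eq closure_arc)
  have "v \<in> g i ` {0..1} \<longleftrightarrow> g i 0 = v" if "v \<in> black D" "i < d" for v i
    using lift[OF that(2)] that(1) by (force simp: black_iff)
  then show "v \<in> black D \<Longrightarrow> edges_at D v = arc ` {i. i < d \<and> g i 0 = v}"
    unfolding * by (metis (mono_tags, lifting))
  have "v \<in> g i ` {0..1} \<longleftrightarrow> g i 1 = v" if "v \<in> white D" "i < d" for v i
    using lift[OF that(2)] that(1) by (force simp: white_iff)
  then show "v \<in> white D \<Longrightarrow> edges_at D v = arc ` {i. i < d \<and> g i 1 = v}"
    unfolding * by (metis (mono_tags, lifting))
qed

lemma card_arc_image: "card (arc ` {i. i < d \<and> P i}) = card {i. i < d \<and> P i}"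
  by (intro card_image inj_on_subset[OF inj_arc]) auto

lemma vertex_degree_eq_ram_index:
  "v \<in> black D \<union> white D \<Longrightarrow> vertex_degree D v = ram_index p q v"
  using ram[of 0 v] ram[of 1 v]
  by (auto simp: vertex_degree_def edges_at_black edges_at_white card_arc_image black_iff white_iff)

lemma edges_between_eq:
  assumes "b \<in> black D" "w \<in> white D"
  shows "edges_between D b w = arc ` {i. i < d \<and> g i 0 = b \<and> g i 1 = w}"
proof -
  have "arc ` {i. i < d \<and> g i 0 = b} \<inter> arc ` {i. i < d \<and> g i 1 = w}
      = arc ` ({i. i < d \<and> g i 0 = b} \<inter> {i. i < d \<and> g i 1 = w})"
    by (rule inj_on_image_Int[OF inj_arc, symmetric]) auto
  then show ?thesis
    unfolding edges_between_def edges_at_black[OF assms(1)] edges_at_white[OF assms(2)]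
    by (simp add: Collect_conj_eq[symmetric] conj_ac)
qed

lemma drawing_eq: "black D \<union> white D \<union> \<Union>(edges D) = (\<Union>i<d. g i ` {0..1})"
  unfolding closed_arc_eq edges_eq black_starts white_ends by auto

lemma connected_drawing: "connectedin P1_top (\<Union>i<d. g i ` {0..1})"
proof -
  have "{x. \<exists>t\<in>{0..1::real}. P1_map p q x = Some (of_real t)} = (\<Union>i<d. g i ` {0..1})"
  proof
    show "{x. \<exists>t\<in>{0..1::real}. P1_map p q x = Some (of_real t)} \<subseteq> (\<Union>i<d. g i ` {0..1})"
      using full by fast
    show "(\<Union>i<d. g i ` {0..1}) \<subseteq> {x. \<exists>t\<in>{0..1::real}. P1_map p q x = Some (of_real t)}"
      using lift by auto
  qed
  then show ?thesis using connected by simp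
qed

lemma planar: "planar_dessin D"
  unfolding planar_dessin_def
proof (intro conjI ballI)
  show "finite (black D)" "finite (white D)" "finite (edges D)"
    by (simp_all add: black_starts white_ends edges_eq)
  show "black D \<inter> white D = {}" by (auto simp: black_iff white_iff)
  show "connectedin P1_top (black D \<union> white D \<union> \<Union>(edges D))"
    unfolding drawing_eq by (rule connected_drawing)
  show "pairwise disjnt (edges D)"
    using arc_disjoint by (auto simp: edges_eq pairwise_def disjnt_def)
  fix e assume "e \<in> edges D"
  then obtain i where i: "i < d" "e = arc i" by (auto simp: edges_eq)
  then show "edge_arc D e"
    using embedding start_black end_white by (auto simp: edge_arc_def arc_def)
  have "e \<subseteq> open_preimage" using i by (auto simp: open_preimage_eq)
  then show "e \<inter> (black D \<union> white D) = {}"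
    by (force simp: open_preimage_def black_iff white_iff)
qed

text \<open>An edge both of whose ends have degree one would be a whole connected component.\<close>
lemma edge_end_ramified:
  assumes "d \<ge> 2" "i < d"
  shows "ram_index p q (g i 0) \<noteq> 1 \<or> ram_index p q (g i 1) \<noteq> 1"
proof (rule ccontr)
  assume "\<not> ?thesis"
  moreover have "P1_map p q (g i 0) = Some (of_real 0)" "P1_map p q (g i 1) = Some (of_real 1)"
    using lift[OF assms(2), of 0] lift[OF assms(2), of 1] by auto
  ultimately have "card {j. j < d \<and> g j 0 = g i 0} = 1" "card {j. j < d \<and> g j 1 = g i 1} = 1"
    using ram[of 0 "g i 0"] ram[of 1 "g i 1"] by simp_all
  then obtain j0 j1 where only: "{j. j < d \<and> g j 0 = g i 0} = {j0}" "{j. j < d \<and> g j 1 = g i 1} = {j1}"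
    by (auto simp: card_1_singleton_iff)
  have ends: "j = i" if "j < d" "g j 0 = g i 0 \<or> g j 1 = g i 1" for j
    using that(2)
  proof
    assume "g j 0 = g i 0"
    then have "j \<in> {j0}" "i \<in> {j0}" unfolding only(1)[symmetric] using that(1) assms(2) by simp_all
    then show ?thesis by simp
  next
    assume "g j 1 = g i 1"
    then have "j \<in> {j1}" "i \<in> {j1}" unfolding only(2)[symmetric] using that(1) assms(2) by simp_all
    then show ?thesis by simp
  qed
  let ?A = "g i ` {0..1}" and ?B = "\<Union>j\<in>{..<d} - {i}. g j ` {0..1}"
  \<comment> \<open>A common point has equal parameters on both arcs. Inside the interval
    \<open>inj\<close> excludes it, and at the ends \<open>ends\<close> does.\<close>
  have disj: "?A \<inter> ?B = {}"
  proof (rule ccontr)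
    assume "?A \<inter> ?B \<noteq> {}"
    then obtain x j where "x \<in> ?A" "j < d" "j \<noteq> i" "x \<in> g j ` {0..1}" by blast
    then obtain s t where j: "j < d" "j \<noteq> i" "s \<in> {0..1}" "t \<in> {0..1}" "g i s = g j t" by auto
    then have "s = t" using lift_eq[of i j s t] assms(2) by simp
    then have "t = 0 \<or> t = 1 \<or> (0 < t \<and> t < 1)" "g i t = g j t" using j by auto
    then show False using ends[OF j(1)] inj[OF assms(2) j(1)] j(2) by auto
  qed
  have closed: "closedin P1_top ?A" "closedin P1_top ?B"
    using closed_arc assms(2) by (auto intro!: closedin_Union)
  have "(\<Union>j<d. g j ` {0..1}) = ?A \<union> ?B" using assms(2) by auto
  then have "connectedin P1_top (?A \<union> ?B)" using connected_drawing by simp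
  then have "?A = {} \<or> ?B = {}" using closed disj by (rule connectedin_closed_Un)
  \<comment> \<open>Here \<open>d \<ge> 2\<close> enters: a second arc makes \<open>?B\<close>
    nonempty.\<close>
  moreover have "\<exists>j<d. j \<noteq> i" using assms by (intro exI[of _ "if i = 0 then 1 else 0"]) auto
  ultimately show False by auto
qed

end

section \<open>Counting arcs at the two ramified vertices\<close>

theorem theorem2p1:
  fixes p q :: "complex poly" and d e0 e1 einf :: nat
  assumes "d \<ge> 3"
    and "map_degree p q = d"
    and "single_cycle_belyi_map p q"
    and "combinatorial_type p q = (e0, e1, einf)"
  shows "planar_dessin (dessin_of p q) \<and>
    (\<exists>b \<in> black (dessin_of p q). \<exists>w \<in> white (dessin_of p q).
       vertex_degree (dessin_of p q) b = e0 \<and>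
       vertex_degree (dessin_of p q) w = e1 \<and>
       int (card (white (dessin_of p q) - {w})) = int d - int e1 \<and>
       (\<forall>v \<in> white (dessin_of p q) - {w}.
          vertex_degree (dessin_of p q) v = 1 \<and> edges_between (dessin_of p q) b v \<noteq> {}) \<and>
       int (card (black (dessin_of p q) - {b})) = int d - int e0 \<and>
       (\<forall>v \<in> black (dessin_of p q) - {b}.
          vertex_degree (dessin_of p q) v = 1 \<and> edges_between (dessin_of p q) v w \<noteq> {}) \<and>
       int (card (edges_between (dessin_of p q) b w)) = int e0 + int e1 - int d)"
proof -
  have belyi: "belyi_map p q"
    and uniq: "\<exists>!x. P1_map p q x = Some c \<and> ram_index p q x > 1" if "c = 0 \<or> c = 1" for c
    using assms(3) that by (auto simp: single_cycle_belyi_map_def)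
  obtain g where "dessin_arcs p q d g" using dessin_arcs_exist[OF belyi] assms(2) by auto
  then interpret dessin_arcs p q d g .
  have crit: "\<exists>x. P1_map p q x = Some c \<and> ram_index p q x = crit_index p q (Some c) \<and>
      (\<forall>y. P1_map p q y = Some c \<and> ram_index p q y > 1 \<longrightarrow> y = x)" if "c = 0 \<or> c = 1" for c
    using theI'[OF uniq[OF that]] uniq[OF that] unfolding crit_index_def by blast
  obtain b where b: "b \<in> black D" "ram_index p q b = e0"
      "\<And>y. y \<in> black D \<Longrightarrow> ram_index p q y > 1 \<Longrightarrow> y = b"
    using crit[of 0] assms(4) by (auto simp: combinatorial_type_def black_iff)
  obtain w where w: "w \<in> white D" "ram_index p q w = e1"
      "\<And>y. y \<in> white D \<Longrightarrow> ram_index p q y > 1 \<Longrightarrow> y = w"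
    using crit[of 1] assms(4) by (auto simp: combinatorial_type_def white_iff)
  have card0: "card {i. i < d \<and> g i 0 = v} = ram_index p q v" if "v \<in> black D" for v
    using ram[of 0 v] that by (simp add: black_iff)
  have card1: "card {i. i < d \<and> g i 1 = v} = ram_index p q v" if "v \<in> white D" for v
    using ram[of 1 v] that by (simp add: white_iff)
  \<comment> \<open>Every vertex is the end of some arc, so its index is not 0, and only b has an
    index above 1.\<close>
  have deg_black: "ram_index p q v = 1" if "v \<in> black D - {b}" for v
  proof -
    have "{i. i < d \<and> g i 0 = v} \<noteq> {}" using that by (auto simp: black_starts)
    moreover have "finite {i. i < d \<and> g i 0 = v}" by simp
    ultimately have "ram_index p q v \<noteq> 0" using card0[of v] that by (metis DiffD1 card_0_eq)
    then show ?thesis using b(3)[of v] that by fastforce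
  qed
  have deg_white: "ram_index p q v = 1" if "v \<in> white D - {w}" for v
  proof -
    have "{i. i < d \<and> g i 1 = v} \<noteq> {}" using that by (auto simp: white_ends)
    moreover have "finite {i. i < d \<and> g i 1 = v}" by simp
    ultimately have "ram_index p q v \<noteq> 0" using card1[of v] that by (metis DiffD1 card_0_eq)
    then show ?thesis using w(3)[of v] that by fastforce
  qed
  have fin: "finite (black D)" "finite (white D)" by (simp_all add: black_starts white_ends)
  \<comment> \<open>Every vertex other than x carries exactly one arc, so arcs that avoid x
    correspond to these vertices.\<close>
  have count: "card {i. i < d \<and> h i \<noteq> x} = card (X - {x})"
    if "finite X" "\<And>i. i < d \<Longrightarrow> h i \<in> X" "\<And>v. v \<in> X - {x} \<Longrightarrow> card {i. i < d \<and> h i = v} = 1"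
    for h :: "nat \<Rightarrow> P1" and x X
  proof -
    have "{i. i < d \<and> h i \<noteq> x} = (\<Union>v\<in>X - {x}. {i. i < d \<and> h i = v})" using that(2) by auto
    also have "card \<dots> = (\<Sum>v\<in>X - {x}. card {i. i < d \<and> h i = v})"
      using that(1) by (intro card_UN_disjoint) auto
    finally show ?thesis using that(3) by simp
  qed
  have compl: "card {i. i < d \<and> h i \<noteq> x} + card {i. i < d \<and> h i = x} = d" for h :: "nat \<Rightarrow> P1" and x
  proof -
    have "{i. i < d \<and> h i \<noteq> x} \<union> {i. i < d \<and> h i = x} = {..<d}" by auto
    moreover have "{i. i < d \<and> h i \<noteq> x} \<inter> {i. i < d \<and> h i = x} = {}" by auto
    ultimately show ?thesis using card_Un_disjoint[of "{i. i < d \<and> h i \<noteq> x}" "{i. i < d \<and> h i = x}"] by simp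
  qed
  have "card {i. i < d \<and> g i 0 \<noteq> b} = card (black D - {b})"
    by (rule count[OF fin(1) start_black]) (use card0 deg_black in \<open>simp_all\<close>)
  then have cb: "card (black D - {b}) + e0 = d"
    using compl[of "\<lambda>i. g i 0" b] card0[OF b(1)] b(2) by simp
  have w': "card {i. i < d \<and> g i 1 \<noteq> w} = card (white D - {w})"
    by (rule count[OF fin(2) end_white]) (use card1 deg_white in \<open>simp_all\<close>)
  then have cw: "card (white D - {w}) + e1 = d"
    using compl[of "\<lambda>i. g i 1" w] card1[OF w(1)] w(2) by simp
  have touch: "g i 0 = b \<or> g i 1 = w" if "i < d" for i
    using edge_end_ramified[of i] deg_black deg_white start_black end_white that assms(1) by fastforce
  \<comment> \<open>By \<open>touch\<close>, each of the \<open>d - e1\<close> arcs that miss w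
    starts at b. Removing them from the \<open>e0\<close> arcs at b leaves those that join b to
    w.\<close>
  have "{i. i < d \<and> g i 0 = b} = {i. i < d \<and> g i 0 = b \<and> g i 1 = w} \<union> {i. i < d \<and> g i 1 \<noteq> w}"
    using touch by auto
  moreover have "{i. i < d \<and> g i 0 = b \<and> g i 1 = w} \<inter> {i. i < d \<and> g i 1 \<noteq> w} = {}" by auto
  ultimately have "e0 = card {i. i < d \<and> g i 0 = b \<and> g i 1 = w} + card {i. i < d \<and> g i 1 \<noteq> w}"
    using card_Un_disjoint[of "{i. i < d \<and> g i 0 = b \<and> g i 1 = w}" "{i. i < d \<and> g i 1 \<noteq> w}"] card0[OF b(1)] b(2)
    by simp
  then have cbw: "card (edges_between D b w) + d = e0 + e1"
    using cw w' by (simp add: edges_between_eq b w card_arc_image)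
  have "edges_between D b v \<noteq> {}" if v: "v \<in> white D - {w}" for v
  proof -
    obtain i where "i < d" "g i 1 = v" using v by (auto simp: white_ends)
    then show ?thesis using touch[of i] v b by (auto simp: edges_between_eq)
  qed
  moreover have "edges_between D v w \<noteq> {}" if v: "v \<in> black D - {b}" for v
  proof -
    obtain i where "i < d" "g i 0 = v" using v by (auto simp: black_starts)
    then show ?thesis using touch[of i] v w by (auto simp: edges_between_eq)
  qed
  ultimately show ?thesis
    using planar b(1,2) w(1,2) cb cw cbw deg_black deg_white
    by (intro conjI ballI bexI[of _ b] bexI[of _ w]) (simp_all add: vertex_degree_eq_ram_index)
qed

end
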